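(* Let $n\ge 3$ be an integer with $n\equiv 1$ or $5 \pmod 6$. Let $G_n$ be the fundamental group of the complement in $S^3$ of Suzuki's theta-$n$ curve $\Theta_n$, presented as $$G_n=\langle x_1,x_2,\ldots,x_n \mid r\rangle,\qquad r=(x_1x_nx_1^{-1})(x_2x_1x_2^{-1})(x_3x_2x_3^{-1})\cdots(x_nx_{n-1}x_n^{-1}).$$ Let $\alpha_n:G_n\to\langle t\mid\emptyset\rangle$ be the homomorphism to the infinite cyclic group with $\alpha_n(x_i)=t$ for $i=1,\ldots,n-1$ and $\alpha_n(x_n)=t^{1-n}$. Let $\rho:G_n\to SL(2;\mathbb{Z}_2)$ be the group representation determined as follows. If $n=6k+5$ with $k\ge 0$: $$\rho(x_i)=\begin{pmatrix}0&1\\1&1\end{pmatrix}\ (1\le i\le 6k+3),\quad \rho(x_{6k+4})=\begin{pmatrix}0&1\\1&0\end{pmatrix},\quad \rho(x_{6k+5})=\begin{pmatrix}1&0\\1&1\end{pmatrix}.$$ If $n=6k+7$ with $k\ge 0$: $$\rho(x_i)=\begin{pmatrix}0&1\\1&1\end{pmatrix}\ (1\le i\le 6k+3),\quad \rho(x_{6k+4})=\rho(x_{6k+6})=\begin{pmatrix}0&1\\1&0\end{pmatrix},\quad \rho(x_{6k+5})=\rho(x_{6k+7})=\begin{pmatrix}1&0\\1&1\end{pmatrix}.$$ Then the twisted Alexander ideals of $G_n$ associated with $\rho$ and $\alpha_n$, which are ideals of $\mathbb{Z}_2[t,t^{-1}]$, are $$E_d\bigl(A(G_n,\tilde\rho\otimes\tilde\alpha_n)\bigr)=\begin{cases}(0)&(d<2n-2),\\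 (1+t)&(d=2n-2),\\ (1)&(d\ge 2n-1).\end{cases}$$
   Context: $\mathbb{Z}_2=\mathbb{Z}/2\mathbb{Z}$. For the purposes of the statement, $G_n$ is the abstract group given by the displayed one-relator presentation (this is the fundamental group of the complement of Suzuki's theta-$n$ curve $\Theta_n$, a spatial theta-$n$ graph in $S^3$; $\Theta_3$ is Kinoshita's theta curve). The relator $r$ is sent to the identity by both $\alpha_n$ and $\rho$, so these are well-defined homomorphisms on $G_n$. Fox derivatives: for the free group $F_n$ on $x_1,\ldots,x_n$ with identity $e$, $\frac{\partial}{\partial x_i}:\mathbb{Z}F_n\to\mathbb{Z}F_n$ is the additive map with $\frac{\partial x_j}{\partial x_i}=e$ if $i=j$ and $0$ if $i\ne j$, and $\frac{\partial(uv)}{\partial x_i}=\frac{\partial u}{\partial x_i}+u\frac{\partial v}{\partial x_i}$ for $u,v\in F_n$. Twisted Alexander matrix: let $\tilde\phi:\mathbb{Z}F_n\to\mathbb{Z}G_n$ be the linear extension of the canonical epimorphism $F_n\to G_n$, and let $\tilde\rho\otimes\tilde\alpha_n:\mathbb{Z}G_n\to M_2(\mathbb{Z}_2[t,t^{-1}])$ be defined by $(\tilde\rho\otimes\tilde\alpha_n)(\sum_i c_ig_i)=\sum_i c_i\,\alpha_n(g_i)\rho(g_i)$ for $c_i\in\mathbb{Z}$, $g_i\in G_n$. Then $A(G_n,\tilde\rho\otimes\tilde\alpha_n)$ is the matrix consisting of the single row of $2\times 2$ blocks $(\tilde\rho\otimes\tilde\alpha_n)\circ\tilde\phi\left(\frac{\partial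 r}{\partial x_j}\right)$, $j=1,\ldots,n$, followed by infinitely many zero rows; it is regarded as an $\infty\times 2n$ matrix over $\mathbb{Z}_2[t,t^{-1}]$ in which only the first $2$ rows can be nonzero. Elementary ideals: for an $\infty\times s$ matrix $A$ over a commutative ring $P$ with unity in which only the first $q$ rows contain nonzero entries, the $d$-th elementary ideal $E_d(A)$ is the ideal of $P$ generated by all $(s-d)$-minors of $A$ if $0<s-d\le q$; it is $(0)$ if $s-d>q$, and $(1)=P$ if $s-d\le 0$. Here $s=2n$, $q=2$, $P=\mathbb{Z}_2[t,t^{-1}]$. These ideals do not depend on the chosen presentation of $G_n$. *)

theory Defs
  imports
    "HOL-Algebra.Elementary_Groups"
    "HOL-Algebra.Generated_Groups"
    "HOL-Algebra.Ideal"
    "HOL-Library.Poly_Mapping"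
    "HOL-Library.Z2"
    "Jordan_Normal_Form.Determinant"
begin

section \<open>Free groups\<close>

text \<open>The letter \<open>(x, True)\<close> stands for \<open>x\<close> and \<open>(x, False)\<close> for its inverse. The free group
  consists of the reduced words, multiplied by concatenation followed by cancellation.\<close>

type_synonym 'a letter = "'a \<times> bool"

definition letter_inv :: "'a letter \<Rightarrow> 'a letter" where
  "letter_inv a = (fst a, \<not> snd a)"

definition cons_red :: "'a letter \<Rightarrow> 'a letter list \<Rightarrow> 'a letter list" where
  "cons_red a w = (case w of [] \<Rightarrow> [a] | b # v \<Rightarrow> if b = letter_inv a then v else a # w)"

definition reduced :: "'a letter list \<Rightarrow> bool" where
  "reduced w \<longleftrightarrow> successively (\<lambda>a b. b \<noteq> letter_inv a) w"

definition free_group :: "'a set \<Rightarrow> 'a letter list monoid" where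
  "free_group S = \<lparr>carrier = {w. set w \<subseteq> S \<times> UNIV \<and> reduced w}, monoid.mult = foldr cons_red, one = []\<rparr>"

definition free_gen :: "'a \<Rightarrow> 'a letter list" where
  "free_gen x = [(x, True)]"

lemma letter_inv_simps [simp]:
  "letter_inv (letter_inv a) = a" "letter_inv a \<noteq> a" "a \<noteq> letter_inv a"
  "fst (letter_inv a) = fst a" "letter_inv a = letter_inv b \<longleftrightarrow> a = b"
  by (auto simp: letter_inv_def prod_eq_iff)

lemma reduced_Nil [simp]: "reduced []"
  by (simp add: reduced_def)

lemma reduced_Cons: "reduced (a # w) \<longleftrightarrow> reduced w \<and> (w = [] \<or> hd w \<noteq> letter_inv a)"
  by (cases w) (auto simp: reduced_def)

lemma cons_red_reduced: "reduced (a # w) \<Longrightarrow> cons_red a w = a # w"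
  by (cases w) (auto simp: cons_red_def reduced_Cons)

lemma reduced_cons_red: "reduced w \<Longrightarrow> reduced (cons_red a w)"
  by (cases w) (auto simp: cons_red_def reduced_Cons)

lemma set_cons_red: "set (cons_red a w) \<subseteq> insert a (set w)"
  by (cases w) (auto simp: cons_red_def)

lemma cons_red_cancel: "reduced w \<Longrightarrow> cons_red a (cons_red (letter_inv a) w) = w"
  by (cases w) (auto simp: cons_red_def reduced_Cons split: list.splits)

lemma reduced_foldr: "reduced v \<Longrightarrow> reduced (foldr cons_red u v)"
  by (induction u) (auto intro: reduced_cons_red)

lemma set_foldr: "set (foldr cons_red u v) \<subseteq> set u \<union> set v"
proof (induction u)
  case (Cons a u)
  then show ?case using set_cons_red[of a "foldr cons_red u v"] by auto
qed simp

lemma foldr_Nil: "reduced u \<Longrightarrow> foldr cons_red u [] = u"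
  by (induction u) (auto simp: reduced_Cons cons_red_reduced)

lemma foldr_cons_red:
  assumes "reduced w"
  shows "foldr cons_red (cons_red a v) w = cons_red a (foldr cons_red v w)"
proof (cases "\<exists>v'. v = letter_inv a # v'")
  case True
  then obtain v' where "v = letter_inv a # v'" by blast
  then show ?thesis
    using cons_red_cancel[OF reduced_foldr[OF assms]] by (simp add: cons_red_def)
next
  case False
  then have "cons_red a v = a # v" by (cases v) (auto simp: cons_red_def)
  then show ?thesis by simp
qed

lemma foldr_assoc:
  "reduced w \<Longrightarrow> foldr cons_red (foldr cons_red u v) w = foldr cons_red u (foldr cons_red v w)"
  by (induction u) (auto simp: foldr_cons_red)

lemma foldr_inverse:
  "reduced w \<Longrightarrow> foldr cons_red (rev (map letter_inv u)) (foldr cons_red u w) = w"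
proof (induction u arbitrary: w)
  case (Cons a u)
  then show ?case
    using cons_red_cancel[OF reduced_foldr[OF Cons.prems], of "letter_inv a"] by simp
qed simp

lemma free_group_simps:
  "carrier (free_group S) = {w. set w \<subseteq> S \<times> UNIV \<and> reduced w}"
  "u \<otimes>\<^bsub>free_group S\<^esub> v = foldr cons_red u v"
  "\<one>\<^bsub>free_group S\<^esub> = []"
  by (simp_all add: free_group_def)

theorem group_free_group: "group (free_group S)"
proof (rule groupI)
  fix u v assume "u \<in> carrier (free_group S)" "v \<in> carrier (free_group S)"
  then show "u \<otimes>\<^bsub>free_group S\<^esub> v \<in> carrier (free_group S)"
    using set_foldr[of u v] by (auto simp: free_group_simps reduced_foldr)
next
  fix u assume u: "u \<in> carrier (free_group S)"
  define v where "v = foldr cons_red (rev (map letter_inv u)) []"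
  have "set v \<subseteq> S \<times> UNIV"
    using set_foldr[of "rev (map letter_inv u)" "[]"] u
    by (force simp: free_group_simps v_def letter_inv_def)
  moreover have "reduced v" by (simp add: v_def reduced_foldr)
  moreover have "foldr cons_red v u = []"
    unfolding v_def using u foldr_inverse[of "[]" u]
    by (simp add: foldr_assoc foldr_Nil free_group_simps)
  ultimately show "\<exists>v\<in>carrier (free_group S). v \<otimes>\<^bsub>free_group S\<^esub> u = \<one>\<^bsub>free_group S\<^esub>"
    by (auto simp: free_group_simps)
qed (auto simp: free_group_simps foldr_assoc)

lemma free_gen_in_carrier: "x \<in> S \<Longrightarrow> free_gen x \<in> carrier (free_group S)"
  by (auto simp: free_group_simps free_gen_def reduced_Cons)


section \<open>Group presentations\<close>

definition normal_closure :: "('g, 'b) monoid_scheme \<Rightarrow> 'g set \<Rightarrow> 'g set" where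
  "normal_closure G R =
     generate G {g \<otimes>\<^bsub>G\<^esub> r \<otimes>\<^bsub>G\<^esub> inv\<^bsub>G\<^esub> g |g r. g \<in> carrier G \<and> r \<in> R}"

lemma (in group) normal_closure_normal:
  assumes "R \<subseteq> carrier G"
  shows "normal_closure G R \<lhd> G"
  unfolding normal_closure_def
proof (rule normal_generateI)
  fix h g
  assume "h \<in> {g \<otimes> r \<otimes> inv g |g r. g \<in> carrier G \<and> r \<in> R}" and g: "g \<in> carrier G"
  then obtain a r where a: "a \<in> carrier G" "r \<in> R" "h = a \<otimes> r \<otimes> inv a" by blast
  then have "g \<otimes> h \<otimes> inv g = (g \<otimes> a) \<otimes> r \<otimes> inv (g \<otimes> a)"
    using assms g by (auto simp: m_assoc inv_mult_group subset_iff)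
  then show "g \<otimes> h \<otimes> inv g \<in> {g \<otimes> r \<otimes> inv g |g r. g \<in> carrier G \<and> r \<in> R}"
    using a g by blast
qed (use assms in auto)

definition presented_group :: "'a set \<Rightarrow> 'a letter list set \<Rightarrow> 'a letter list set monoid" where
  "presented_group S R = free_group S Mod normal_closure (free_group S) R"

definition canonical_epi :: "'a set \<Rightarrow> 'a letter list set \<Rightarrow> 'a letter list \<Rightarrow> 'a letter list set" where
  "canonical_epi S R w = normal_closure (free_group S) R #>\<^bsub>free_group S\<^esub> w"


section \<open>Integral group rings and Fox derivatives\<close>

text \<open>Elements of the integral group ring of \<open>G\<close> are the finitely supported integer-valued
  functions with support in \<open>carrier G\<close>; \<open>frag_of g\<close> is the group element \<open>g\<close>, and
  \<open>frag_extend f\<close> is the \<open>\<int>\<close>-linear map extending \<open>f\<close>.\<close>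

definition int_group_ring :: "('g, 'b) monoid_scheme \<Rightarrow> ('g \<Rightarrow>\<^sub>0 int) ring" where
  "int_group_ring G =
     \<lparr>carrier = {a. Poly_Mapping.keys a \<subseteq> carrier G},
      monoid.mult = (\<lambda>a b. frag_extend (\<lambda>g. frag_extend (\<lambda>h. frag_of (g \<otimes>\<^bsub>G\<^esub> h)) b) a),
      one = frag_of \<one>\<^bsub>G\<^esub>,
      zero = 0,
      add = (+)\<rparr>"

definition is_fox_derivative ::
    "'a set \<Rightarrow> 'a \<Rightarrow> (('a letter list \<Rightarrow>\<^sub>0 int) \<Rightarrow> ('a letter list \<Rightarrow>\<^sub>0 int)) \<Rightarrow> bool" where
  "is_fox_derivative S x D \<longleftrightarrow>
     (let F = free_group S; ZF = int_group_ring F in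
       D \<in> carrier ZF \<rightarrow>\<^sub>E carrier ZF \<and>
       (\<forall>a\<in>carrier ZF. \<forall>b\<in>carrier ZF. D (a \<oplus>\<^bsub>ZF\<^esub> b) = D a \<oplus>\<^bsub>ZF\<^esub> D b) \<and>
       (\<forall>y\<in>S. D (frag_of (free_gen y)) = (if x = y then \<one>\<^bsub>ZF\<^esub> else \<zero>\<^bsub>ZF\<^esub>)) \<and>
       (\<forall>u\<in>carrier F. \<forall>v\<in>carrier F.
          D (frag_of (u \<otimes>\<^bsub>F\<^esub> v)) =
            D (frag_of u) \<oplus>\<^bsub>ZF\<^esub> (frag_of u \<otimes>\<^bsub>ZF\<^esub> D (frag_of v))))"

definition fox_derivative ::
    "'a set \<Rightarrow> 'a \<Rightarrow> ('a letter list \<Rightarrow>\<^sub>0 int) \<Rightarrow> ('a letter list \<Rightarrow>\<^sub>0 int)" where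
  "fox_derivative S x = (THE D. is_fox_derivative S x D)"

text \<open>The definite description is justified by \<open>fox_derivative_ex1\<close> below, whose proof uses the
  explicit formula on words given by \<open>fox_word\<close>.\<close>

definition left_mult :: "'a letter list \<Rightarrow> ('a letter list \<Rightarrow>\<^sub>0 int) \<Rightarrow> ('a letter list \<Rightarrow>\<^sub>0 int)" where
  "left_mult u p = frag_extend (\<lambda>v. frag_of (foldr cons_red u v)) p"

definition fox_letter :: "'a \<Rightarrow> 'a letter \<Rightarrow> ('a letter list \<Rightarrow>\<^sub>0 int)" where
  "fox_letter x a = (if fst a \<noteq> x then 0 else if snd a then frag_of [] else - frag_of [a])"

fun fox_word :: "'a \<Rightarrow> 'a letter list \<Rightarrow> ('a letter list \<Rightarrow>\<^sub>0 int)" where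
  "fox_word x [] = 0"
| "fox_word x (a # w) = fox_letter x a + left_mult [a] (fox_word x w)"

lemma int_group_ring_simps:
  "carrier (int_group_ring G) = {a. Poly_Mapping.keys a \<subseteq> carrier G}"
  "\<one>\<^bsub>int_group_ring G\<^esub> = frag_of \<one>\<^bsub>G\<^esub>"
  "\<zero>\<^bsub>int_group_ring G\<^esub> = 0"
  "a \<oplus>\<^bsub>int_group_ring G\<^esub> b = a + b"
  by (simp_all add: int_group_ring_def)

lemma frag_of_mult_free:
  "frag_of u \<otimes>\<^bsub>int_group_ring (free_group S)\<^esub> p = left_mult u p"
  by (simp add: int_group_ring_def left_mult_def free_group_simps)

lemma left_mult_add: "left_mult u (p + q) = left_mult u p + left_mult u q"
  by (simp add: left_mult_def frag_extend_add)

lemma left_mult_minus: "left_mult u (- p) = - left_mult u p"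
  by (simp add: left_mult_def frag_extend_minus)

lemma left_mult_0 [simp]: "left_mult u 0 = 0"
  by (simp add: left_mult_def)

lemma left_mult_frag_of [simp]: "left_mult u (frag_of v) = frag_of (foldr cons_red u v)"
  by (simp add: left_mult_def)

lemma left_mult_keys:
  assumes "u \<in> carrier (free_group S)" "Poly_Mapping.keys p \<subseteq> carrier (free_group S)"
  shows "Poly_Mapping.keys (left_mult u p) \<subseteq> carrier (free_group S)"
proof
  fix w assume "w \<in> Poly_Mapping.keys (left_mult u p)"
  then obtain v where v: "v \<in> Poly_Mapping.keys p" "w = foldr cons_red u v"
    unfolding left_mult_def
    using keys_frag_extend[of "\<lambda>v. frag_of (foldr cons_red u v)" p] by (auto simp: keys_frag_of)
  interpret group "free_group S" by (rule group_free_group)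
  show "w \<in> carrier (free_group S)"
    using m_closed[OF assms(1), of v] assms(2) v by (auto simp: free_group_simps(2))
qed

lemma left_mult_left_mult:
  assumes "\<And>w. w \<in> Poly_Mapping.keys p \<Longrightarrow> reduced w"
  shows "left_mult u (left_mult v p) = left_mult (foldr cons_red u v) p"
proof -
  have "frag_extend f (frag_extend (\<lambda>w. frag_of (g w)) c) = frag_extend (\<lambda>w. f (g w)) c"
    for f :: "'a letter list \<Rightarrow> 'a letter list \<Rightarrow>\<^sub>0 int" and g :: "'a letter list \<Rightarrow> 'a letter list" and c
    by (induction c rule: frag_induction[OF subset_UNIV]) (auto simp: frag_extend_diff)
  then show ?thesis
    unfolding left_mult_def by (auto intro!: frag_extend_eq simp: foldr_assoc assms)
qed

lemma left_mult_Nil [simp]: "left_mult [] p = p"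
  using frag_expansion[of p] by (simp add: left_mult_def)

lemma fox_letter_keys: "fst a \<in> S \<Longrightarrow> Poly_Mapping.keys (fox_letter x a) \<subseteq> carrier (free_group S)"
  by (cases a) (auto simp: fox_letter_def keys_frag_of free_group_simps reduced_Cons)

lemma fox_word_keys:
  "set w \<subseteq> S \<times> UNIV \<Longrightarrow> Poly_Mapping.keys (fox_word x w) \<subseteq> carrier (free_group S)"
proof (induction w)
  case (Cons a w)
  have "[a] \<in> carrier (free_group S)" using Cons.prems by (auto simp: free_group_simps reduced_Cons)
  then have "Poly_Mapping.keys (left_mult [a] (fox_word x w)) \<subseteq> carrier (free_group S)"
    using Cons by (intro left_mult_keys) auto
  moreover have "Poly_Mapping.keys (fox_letter x a) \<subseteq> carrier (free_group S)"
    using Cons.prems by (intro fox_letter_keys) auto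
  ultimately show ?case
    using keys_add[of "fox_letter x a" "left_mult [a] (fox_word x w)"] by auto
qed simp

lemma fox_word_reduced: "p \<in> Poly_Mapping.keys (fox_word x w) \<Longrightarrow> reduced p"
  using fox_word_keys[of w UNIV x] by (auto simp: free_group_simps)

lemma fox_letter_cancel: "fox_letter x a + left_mult [a] (fox_letter x (letter_inv a)) = 0"
  by (cases a) (auto simp: fox_letter_def letter_inv_def left_mult_minus cons_red_def)

lemma fox_word_cons_red:
  assumes "reduced w"
  shows "fox_word x (cons_red a w) = fox_letter x a + left_mult [a] (fox_word x w)"
proof (cases "\<exists>v. w = letter_inv a # v")
  case True
  then obtain v where v: "w = letter_inv a # v" by blast
  have "left_mult [a] (left_mult [letter_inv a] (fox_word x v)) = fox_word x v"
    by (subst left_mult_left_mult) (auto simp: fox_word_reduced cons_red_def)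
  then show ?thesis
    using fox_letter_cancel[of x a]
    by (simp add: v left_mult_add cons_red_def flip: add.assoc)
next
  case False
  then have "cons_red a w = a # w" by (cases w) (auto simp: cons_red_def)
  then show ?thesis by simp
qed

lemma fox_word_mult:
  assumes "reduced u" "reduced v"
  shows "fox_word x (foldr cons_red u v) = fox_word x u + left_mult u (fox_word x v)"
  using assms(1)
proof (induction u)
  case (Cons a u)
  then have u: "reduced u" "foldr cons_red [a] u = a # u"
    by (auto simp: reduced_Cons cons_red_reduced)
  have "left_mult [a] (left_mult u (fox_word x v)) = left_mult (a # u) (fox_word x v)"
    using u(2) by (subst left_mult_left_mult) (auto simp: fox_word_reduced)
  then show ?case
    using Cons.IH u(1)
    by (simp add: fox_word_cons_red reduced_foldr assms(2) left_mult_add add.assoc)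
qed simp

theorem fox_derivative_ex1: "\<exists>!D. is_fox_derivative S x D"
proof (rule ex_ex1I)
  let ?F = "free_group S" and ?ZF = "int_group_ring (free_group S)"
  interpret F: group ?F by (rule group_free_group)
  define D where "D = restrict (frag_extend (fox_word x)) (carrier ?ZF)"
  have D_of: "D (frag_of u) = fox_word x u" if "u \<in> carrier ?F" for u
    using that by (simp add: D_def int_group_ring_simps keys_frag_of)
  have "D \<in> carrier ?ZF \<rightarrow>\<^sub>E carrier ?ZF"
  proof -
    have "Poly_Mapping.keys (frag_extend (fox_word x) a) \<subseteq> carrier ?F"
      if "Poly_Mapping.keys a \<subseteq> carrier ?F" for a
      using keys_frag_extend[of "fox_word x" a] fox_word_keys[of _ S x] that
      by (fastforce simp: free_group_simps(1))
    then show ?thesis by (auto simp: D_def int_group_ring_simps)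
  qed
  moreover have "D (a + b) = D a + D b" if "a \<in> carrier ?ZF" "b \<in> carrier ?ZF" for a b
    using that keys_add[of a b] by (auto simp: D_def int_group_ring_simps frag_extend_add)
  moreover have "D (frag_of (free_gen y)) = (if x = y then frag_of [] else 0)" if "y \<in> S" for y
    using that by (simp add: D_of free_gen_in_carrier) (auto simp: free_gen_def fox_letter_def)
  moreover have "D (frag_of (u \<otimes>\<^bsub>?F\<^esub> v)) = D (frag_of u) + left_mult u (D (frag_of v))"
    if "u \<in> carrier ?F" "v \<in> carrier ?F" for u v
    using that fox_word_mult[of u v x] by (simp add: D_of) (simp add: free_group_simps)
  ultimately show "\<exists>D. is_fox_derivative S x D"
    by (intro exI[of _ D])
      (simp add: is_fox_derivative_def Let_def frag_of_mult_free int_group_ring_simps free_group_simps(3))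
next
  let ?F = "free_group S" and ?ZF = "int_group_ring (free_group S)"
  interpret F: group ?F by (rule group_free_group)
  fix D E assume DE: "is_fox_derivative S x D" "is_fox_derivative S x E"
  have add: "H (a + b) = H a + H b"
    if "is_fox_derivative S x H" "a \<in> carrier ?ZF" "b \<in> carrier ?ZF" for H a b
    using that by (auto simp: is_fox_derivative_def Let_def int_group_ring_simps)
  have gen: "H (frag_of [(y, True)]) = (if x = y then frag_of [] else 0)"
    if "is_fox_derivative S x H" "y \<in> S" for H y
    using that
    by (auto simp: is_fox_derivative_def Let_def int_group_ring_simps free_gen_def free_group_simps)
  have mult: "H (frag_of (foldr cons_red u v)) = H (frag_of u) + left_mult u (H (frag_of v))"
    if "is_fox_derivative S x H" "u \<in> carrier ?F" "v \<in> carrier ?F" for H u v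
    using that
    unfolding is_fox_derivative_def Let_def frag_of_mult_free int_group_ring_simps(4) free_group_simps(2)
    by blast
  have nil: "H (frag_of []) = 0" if "is_fox_derivative S x H" for H
    using mult[OF that, of "[]" "[]"] by (simp add: free_group_simps)
  have inv: "H (frag_of [(y, False)]) = - left_mult [(y, False)] (H (frag_of [(y, True)]))"
    if H: "is_fox_derivative S x H" and y: "y \<in> S" for H y
  proof -
    have "H (frag_of []) =
        H (frag_of [(y, False)]) + left_mult [(y, False)] (H (frag_of [(y, True)]))"
      using mult[OF H, of "[(y, False)]" "[(y, True)]"] y
      by (simp add: free_group_simps reduced_Cons cons_red_def letter_inv_def)
    then show ?thesis using nil[OF H] by (simp add: eq_neg_iff_add_eq_0)
  qed
  have word: "D (frag_of w) = E (frag_of w)" if "w \<in> carrier ?F" for w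
    using that
  proof (induction w)
    case Nil
    show ?case using DE[THEN nil] by simp
  next
    case (Cons a w)
    then have a: "fst a \<in> S" "[a] \<in> carrier ?F" "w \<in> carrier ?F" "reduced (a # w)"
      by (auto simp: free_group_simps reduced_Cons)
    have "D (frag_of [a]) = E (frag_of [a])"
    proof -
      obtain y b where "a = (y, b)" by fastforce
      then show ?thesis using DE[THEN gen] DE[THEN inv] a(1) by (cases b) simp_all
    qed
    then show ?case
      using DE[THEN mult, of "[a]" w] a Cons.IH by (simp add: cons_red_reduced)
  qed
  have minus: "H (a - b) = H a - H b"
    if H: "is_fox_derivative S x H" and ab: "a \<in> carrier ?ZF" "b \<in> carrier ?ZF" for H a b
  proof -
    have "a - b \<in> carrier ?ZF"
      using ab keys_diff[of a b] by (auto simp: int_group_ring_simps)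
    then have "H (a - b + b) = H (a - b) + H b" using add H ab by blast
    then show ?thesis by simp
  qed
  have "D a = E a" if "Poly_Mapping.keys a \<subseteq> carrier ?F" for a
  proof -
    have "Poly_Mapping.keys a \<subseteq> carrier ?F \<and> D a = E a"
      using that
    proof (induction a rule: frag_induction)
      case zero
      have H0: "H 0 = 0" if "is_fox_derivative S x H" for H
        using add[OF that, of 0 0] by (simp add: int_group_ring_simps)
      show ?case using DE[THEN H0] by simp
    next
      case (one w)
      then show ?case using word by (simp add: keys_frag_of)
    next
      case (diff a b)
      then show ?case using DE[THEN minus, of a b] keys_diff[of a b] by (auto simp: int_group_ring_simps)
    qed
    then show ?thesis by blast
  qed
  moreover have "D \<in> extensional (carrier ?ZF)" "E \<in> extensional (carrier ?ZF)"
    using DE by (auto simp: is_fox_derivative_def Let_def PiE_def)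
  ultimately show "D = E"
    by (auto intro: extensionalityI simp: int_group_ring_simps)
qed


section \<open>Laurent polynomials and elementary ideals\<close>

text \<open>The Laurent polynomial ring in \<open>t\<close> over \<open>\<int>/2\<close> is the monoid algebra of \<open>(\<int>, +)\<close> with
  coefficients in the two-element field \<^typ>\<open>bit\<close>; the product on \<open>\<Rightarrow>\<^sub>0\<close> is convolution.\<close>

type_synonym laurent2 = "int \<Rightarrow>\<^sub>0 bit"

definition t_power :: "int \<Rightarrow> laurent2" where
  "t_power k = Poly_Mapping.single k 1"

definition laurent_const :: "bit \<Rightarrow> laurent2" where
  "laurent_const c = Poly_Mapping.single 0 c"

definition univ_ring :: "'a::comm_ring_1 ring" where
  "univ_ring = \<lparr>carrier = UNIV, monoid.mult = (*), one = 1, zero = 0, add = (+)\<rparr>"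

lemma cring_univ_ring: "cring (univ_ring :: 'a::comm_ring_1 ring)"
proof (rule cringI)
  show "abelian_group (univ_ring :: 'a ring)"
  proof (rule abelian_groupI)
    fix x :: 'a
    show "\<exists>y\<in>carrier univ_ring. y \<oplus>\<^bsub>univ_ring\<^esub> x = \<zero>\<^bsub>univ_ring\<^esub>"
      by (auto simp: univ_ring_def intro: exI[of _ "- x"])
  qed (auto simp: univ_ring_def)
  show "Group.comm_monoid (univ_ring :: 'a ring)"
    by unfold_locales (auto simp: univ_ring_def)
qed (auto simp: univ_ring_def distrib_right)

text \<open>A matrix with infinitely many rows and \<open>s\<close> columns is a function of a row and a column
  index, both counted from 0, of which only the columns below \<open>s\<close> matter.\<close>

definition minors :: "nat \<Rightarrow> (nat \<Rightarrow> nat \<Rightarrow> 'a::comm_ring_1) \<Rightarrow> nat \<Rightarrow> 'a set" where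
  "minors s A k =
     {Determinant.det (mat k k (\<lambda>(i, j). A (f i) (g j))) |f g.
        strict_mono_on {..<k} f \<and> strict_mono_on {..<k} g \<and> g ` {..<k} \<subseteq> {..<s}}"

text \<open>Here \<open>q\<close> is the number of rows outside of which \<open>A\<close> vanishes.\<close>

definition elementary_ideal ::
    "nat \<Rightarrow> nat \<Rightarrow> (nat \<Rightarrow> nat \<Rightarrow> 'a::comm_ring_1) \<Rightarrow> nat \<Rightarrow> 'a set" where
  "elementary_ideal s q A d =
     (if s \<le> d then Idl\<^bsub>univ_ring\<^esub> {1}
      else if s - d \<le> q then Idl\<^bsub>univ_ring\<^esub> (minors s A (s - d))
      else Idl\<^bsub>univ_ring\<^esub> {0})"


section \<open>Twisted Alexander matrices\<close>

definition SL2 :: "bit mat monoid" where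
  "SL2 = \<lparr>carrier = {M \<in> carrier_mat 2 2. Determinant.det M = 1}, monoid.mult = (*), one = 1\<^sub>m 2\<rparr>"

text \<open>The infinite cyclic group \<open>\<langle>t\<rangle>\<close> is \<^const>\<open>integer_group\<close>, the integer \<open>k\<close> representing
  \<open>t\<^sup>k\<close>. The following is the map \<open>\<Sum>\<^sub>i c\<^sub>i g\<^sub>i \<mapsto> \<Sum>\<^sub>i c\<^sub>i \<alpha>(g\<^sub>i) \<rho>(g\<^sub>i)\<close>, written entry by entry
  because the type of matrices of arbitrary size carries no addition for \<^const>\<open>sum\<close>.\<close>

definition twisted_map ::
    "('g \<Rightarrow> bit mat) \<Rightarrow> ('g \<Rightarrow> int) \<Rightarrow> ('g \<Rightarrow>\<^sub>0 int) \<Rightarrow> laurent2 mat" where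
  "twisted_map \<rho> \<alpha> a =
     mat 2 2 (\<lambda>(i, j). \<Sum>g\<in>Poly_Mapping.keys a.
       of_int (Poly_Mapping.lookup a g) * (t_power (\<alpha> g) \<cdot>\<^sub>m map_mat laurent_const (\<rho> g)) $$ (i, j))"

text \<open>The matrix of the presentation \<open>\<langle>x\<^sub>1, \<dots>, x\<^sub>n | r\<rangle>\<close>: one row of \<open>2 \<times> 2\<close> blocks, followed by
  zero rows. Column \<open>c\<close> (counted from 0) is column \<open>c mod 2\<close> of the block of \<open>x\<^sub>j\<close> for
  \<open>j = c div 2 + 1\<close>.\<close>

definition twisted_alexander_matrix ::
    "nat \<Rightarrow> nat letter list \<Rightarrow> (nat letter list set \<Rightarrow> bit mat) \<Rightarrow> (nat letter list set \<Rightarrow> int) \<Rightarrow>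
     nat \<Rightarrow> nat \<Rightarrow> laurent2" where
  "twisted_alexander_matrix n r \<rho> \<alpha> i c =
     (if i < 2 \<and> c < 2 * n then
        twisted_map \<rho> \<alpha>
          (frag_extend (\<lambda>w. frag_of (canonical_epi {1..n} {r} w))
             (fox_derivative {1..n} (c div 2 + 1) (frag_of r))) $$ (i, c mod 2)
      else 0)"


section \<open>The group of Suzuki's theta-n curve\<close>

definition theta_relator :: "nat \<Rightarrow> nat letter list" where
  "theta_relator n =
     (let F = free_group {1..n}; x = free_gen in
      foldr (\<lambda>i w. (x i \<otimes>\<^bsub>F\<^esub> x (if i = 1 then n else i - 1) \<otimes>\<^bsub>F\<^esub> inv\<^bsub>F\<^esub> x i) \<otimes>\<^bsub>F\<^esub> w)
        [1..<n + 1] \<one>\<^bsub>F\<^esub>)"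

definition theta_group :: "nat \<Rightarrow> nat letter list set monoid" where
  "theta_group n = presented_group {1..n} {theta_relator n}"

definition theta_gen :: "nat \<Rightarrow> nat \<Rightarrow> nat letter list set" where
  "theta_gen n i = canonical_epi {1..n} {theta_relator n} (free_gen i)"

end

theory Submission
  imports Defs
begin

text \<open>Put \<open>c\<^sub>i = x\<^sub>i x\<^sub>i\<^sub>-\<^sub>1 x\<^sub>i\<inverse>\<close> with indices modulo \<open>n\<close>, and let
  \<open>P\<^sub>j = c\<^sub>1 \<dots> c\<^sub>j\<^sub>-\<^sub>1\<close>, so that \<open>r = P\<^sub>n\<^sub>+\<^sub>1\<close>. The generator \<open>x\<^sub>j\<close> occurs only in the factors \<open>c\<^sub>j\<close>
  and \<open>c\<^sub>j\<^sub>+\<^sub>1\<close>, and the product rule shows that, after applying the twisted representation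
  \<open>w \<mapsto> t\<^bsup>\<alpha>(w)\<^esup> \<rho>(w)\<close>, the block of \<open>\<partial>r/\<partial>x\<^sub>j\<close> is that of \<open>P\<^sub>j - P\<^sub>j\<^sub>+\<^sub>1 + P\<^sub>j\<^sub>+\<^sub>1 x\<^sub>j\<^sub>+\<^sub>1\<close>
  (\<open>twisted_fox_relator\<close>); for \<open>j = n\<close> this uses that \<open>r\<close> acts trivially.

  The ideals then depend on two facts. First, every entry of the top row is divisible by \<open>1 + t\<close>.
  Modulo \<open>1 + t\<close> each power of \<open>t\<close> becomes 1, so this is a statement about \<open>\<rho>\<close> alone
  (\<open>one_plus_t_dvd_entry\<close>). Where \<open>x\<^sub>j\<^sub>-\<^sub>1, x\<^sub>j, x\<^sub>j\<^sub>+\<^sub>1\<close> are all sent to the element \<open>A\<close> of order 3,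
  the block reduces to \<open>\<rho>(P\<^sub>j) (1 + A + A\<^sup>2) = 0\<close>. The remaining blocks are the first one and
  the last three or five; there \<open>\<rho>(P\<^sub>j)\<close> is obtained by going back from \<open>P\<^sub>n\<^sub>+\<^sub>1 = r \<mapsto> 1\<close>, with a result
  that does not depend on \<open>n\<close> within each congruence class, and the top row is seen to vanish
  (\<open>fox_sum_top_row\<close>). Hence \<open>1 + t\<close> divides all minors of size 2.

  Secondly, the last column of the block of \<open>x\<^sub>2\<close> is \<open>t\<^bsup>1-n\<^esup> (1 + t, t + t\<^sup>2)\<close> and the first column of
  the block of \<open>x\<^sub>n\<close> is \<open>(t\<^sup>-\<^sup>1 - 1, t)\<close>. Their minor is \<open>t\<^bsup>1-n\<^esup> (1 + t)\<close>, a unit times \<open>1 + t\<close>, and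
  the entry \<open>t\<close> is a unit. This gives the ideals for \<open>d = 2n - 2\<close> and \<open>d = 2n - 1\<close>; the other
  ones are immediate from the shape of the matrix.\<close>

section \<open>Principal ideals and two-by-two matrices\<close>

lemma Idl_univ_ring_eq_principal:
  fixes a :: "'a::comm_ring_1"
  assumes dvd: "\<And>x. x \<in> X \<Longrightarrow> a dvd x" and "b \<in> X" "b dvd a"
  shows "Idl\<^bsub>univ_ring\<^esub> X = Idl\<^bsub>univ_ring\<^esub> {a}"
proof -
  interpret cring "univ_ring :: 'a ring" by (rule cring_univ_ring)
  have carrier: "carrier (univ_ring :: 'a ring) = UNIV" by (simp add: univ_ring_def)
  have mult: "x \<otimes>\<^bsub>univ_ring\<^esub> y = x * y" for x y :: 'a by (simp add: univ_ring_def)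
  have multiples: "y \<in> Idl\<^bsub>univ_ring\<^esub> Y"
    if "x \<in> Y" "x dvd y" for x y :: 'a and Y
  proof -
    have "x \<in> Idl\<^bsub>univ_ring\<^esub> Y" using genideal_self[of Y] that(1) by (auto simp: carrier)
    then show ?thesis
      using ideal.I_r_closed[OF genideal_ideal, of Y x] that(2) by (auto simp: carrier mult)
  qed
  show ?thesis
  proof (rule equalityI; rule genideal_minimal)
    show "X \<subseteq> Idl\<^bsub>univ_ring\<^esub> {a}" using multiples[of a "{a}"] dvd by auto
    show "{a} \<subseteq> Idl\<^bsub>univ_ring\<^esub> X" using multiples[of b X] assms(2,3) by auto
  qed (auto intro: genideal_ideal simp: carrier)
qed

text \<open>Addition and multiplication of two-by-two matrices in this normal form are rewrite rules, and the
  form is the one in which the values of \<open>\<rho>\<close> are given. Concrete computations in \<open>SL(2; \<int>/2)\<close> thereby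
  become simplifications.\<close>
abbreviation (input) mat2 :: "'a \<Rightarrow> 'a \<Rightarrow> 'a \<Rightarrow> 'a \<Rightarrow> 'a mat" where
  "mat2 a b c d \<equiv> mat_of_rows_list 2 [[a, b], [c, d]]"

lemma mat2_carrier [simp]: "mat2 a b c d \<in> carrier_mat 2 2"
  by (simp add: mat_of_rows_list_def numeral_2_eq_2)

lemma mat2_eqI:
  assumes "M \<in> carrier_mat 2 2" "M' \<in> carrier_mat 2 2"
    and "M $$ (0, 0) = M' $$ (0, 0)" "M $$ (0, 1) = M' $$ (0, 1)"
    and "M $$ (1, 0) = M' $$ (1, 0)" "M $$ (1, 1) = M' $$ (1, 1)"
  shows "M = M'"
  using assms by (intro eq_matI) (auto simp: less_2_cases_iff)

lemma mat2_index [simp]: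
  "mat2 a b c d $$ (0, 0) = a" "mat2 a b c d $$ (0, 1) = b"
  "mat2 a b c d $$ (1, 0) = c" "mat2 a b c d $$ (1, 1) = d" "mat2 a b c d $$ (0, Suc 0) = b"
  "mat2 a b c d $$ (Suc 0, 0) = c" "mat2 a b c d $$ (Suc 0, Suc 0) = d"
  by (simp_all add: mat_of_rows_list_def)

lemma mat2_exhaust:
  assumes "M \<in> carrier_mat 2 2"
  obtains a b c d where "M = mat2 a b c d"
  using assms by (intro that mat2_eqI) auto

lemma diff_add_index:
  assumes "M \<in> carrier_mat m k" "M' \<in> carrier_mat m k" "M'' \<in> carrier_mat m k" "i < m" "j < k"
  shows "(M - M' + M'') $$ (i, j) = M $$ (i, j) - M' $$ (i, j) + M'' $$ (i, j)"
  using assms by simp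

lemma sum_upto_2: "(\<Sum>i = 0..<2. f i) = f 0 + f (1 :: nat)"
  by (simp add: numeral_2_eq_2)

lemma mat2_times:
  "mat2 a b c d * mat2 a' b' c' d' =
    (mat2 (a * a' + b * c') (a * b' + b * d') (c * a' + d * c') (c * b' + d * d') :: 'a::comm_ring_1 mat)"
  by (rule mat2_eqI) (auto simp: mat_of_rows_list_def scalar_prod_def)

lemma mat2_plus: "mat2 a b c d + mat2 a' b' c' d' = mat2 (a + a') (b + b') (c + c') (d + d')"
  by (rule mat2_eqI) (auto simp: mat_of_rows_list_def)

lemma mat2_minus:
  "mat2 a b c d - mat2 a' b' c' d' =
    (mat2 (a - a') (b - b') (c - c') (d - d') :: 'a::comm_ring_1 mat)"
  by (rule mat2_eqI) (auto simp: mat_of_rows_list_def)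

lemma one_mat2: "1\<^sub>m 2 = mat2 1 0 0 1"
  by (rule mat2_eqI) (auto simp: mat_of_rows_list_def)

lemma det_mat2: "det (mat2 a b c d) = (a * d - b * c :: 'a::comm_ring_1)"
proof -
  have "det (mat_delete (mat2 a b c d) i 0) = (if i = 0 then d else b)" if "i < 2" for i
    using that
    by (subst det_single) (auto simp: mat_delete_def mat_of_rows_list_def less_2_cases_iff)
  then show ?thesis
    by (subst laplace_expansion_column[of _ 2 0])
      (auto simp: cofactor_def lessThan_atLeast0 sum_upto_2)
qed

lemma det_mat_2_2:
  "det (mat 2 2 h) = (h (0, 0) * h (1, 1) - h (0, 1) * h (1, 0) :: 'a::comm_ring_1)"
proof -
  have "mat 2 2 h = mat2 (h (0, 0)) (h (0, 1)) (h (1, 0)) (h (1, 1))"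
    by (rule mat2_eqI) auto
  then show ?thesis by (simp add: det_mat2)
qed

lemmas mat2_simps = mat2_times mat2_plus mat2_minus one_mat2

section \<open>Homomorphisms into SL2 and the Laurent ring\<close>

lemma SL2_simps:
  "carrier SL2 = {M \<in> carrier_mat 2 2. det M = 1}"
  "M \<otimes>\<^bsub>SL2\<^esub> M' = M * M'"
  "\<one>\<^bsub>SL2\<^esub> = 1\<^sub>m 2"
  by (simp_all add: SL2_def)

lemma group_SL2: "group SL2"
proof (rule groupI)
  fix M assume "M \<in> carrier SL2"
  then have M: "M \<in> carrier_mat 2 2" and det: "det M = 1" by (auto simp: SL2_simps)
  obtain a b c d where abcd: "M = mat2 a b c d" using mat2_exhaust[OF M] .
  have "mat2 d (- b) (- c) a * M = 1\<^sub>m 2" "det (mat2 d (- b) (- c) a) = 1"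
    using det unfolding abcd det_mat2 mat2_simps
    by (simp_all add: algebra_simps del: add_bit_eq_xor mult_bit_eq_and)
  then show "\<exists>N\<in>carrier SL2. N \<otimes>\<^bsub>SL2\<^esub> M = \<one>\<^bsub>SL2\<^esub>"
    by (intro bexI[of _ "mat2 d (- b) (- c) a"]) (auto simp: SL2_simps)
qed (auto simp: SL2_simps det_mult)

lemma t_power_mult: "t_power j * t_power k = t_power (j + k)"
  by (simp add: t_power_def mult_single)

lemma t_power_0: "t_power 0 = 1"
  by (simp add: t_power_def)

lemma laurent_const_0 [simp]: "laurent_const 0 = 0"
  by (simp add: laurent_const_def)

lemma laurent_const_1 [simp]: "laurent_const 1 = 1"
  by (simp add: laurent_const_def)

lemma laurent_const_add: "laurent_const (a + b) = laurent_const a + laurent_const b"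
  unfolding laurent_const_def by (rule single_add)

lemma laurent_const_diff: "laurent_const (a - b) = laurent_const a - laurent_const b"
  unfolding laurent_const_def by (rule single_diff)

lemma laurent_const_mult: "laurent_const (a * b) = laurent_const a * laurent_const b"
  by (simp add: laurent_const_def mult_single)

lemma laurent_uminus: "- (f :: laurent2) = f"
  by (rule poly_mapping_eqI) (simp)

lemma laurent_minus: "(f :: laurent2) - g = f + g"
  using laurent_uminus[of g] by (metis add_uminus_conv_diff)

text \<open>Evaluation at \<open>t = 1\<close>, expressed as a congruence in the Laurent ring.\<close>
lemma one_plus_t_dvd_t_power: "1 + t_power 1 dvd t_power k - 1"
proof -
  have nat: "1 + t_power 1 dvd t_power (int m) - 1" for m
  proof (induction m)
    case (Suc m)
    \<comment> \<open>In characteristic 2 the last summand is \<open>1 + t\<close> itself.\<close>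
    have "t_power (int (Suc m)) - 1 = (t_power (int m) - 1) * t_power 1 + (t_power 1 - 1)"
      by (simp add: left_diff_distrib t_power_mult add.commute)
    moreover have "t_power 1 - 1 = 1 + t_power 1"
      by (simp add: laurent_minus add.commute)
    ultimately show ?case using Suc by (metis dvd_add dvd_mult2 dvd_refl)
  qed (simp add: t_power_0)
  show ?thesis
  proof (cases "k \<ge> 0")
    case True
    then show ?thesis using nat[of "nat k"] by simp
  next
    case False
    then have "t_power k - 1 = - (t_power k * (t_power (int (nat (- k))) - 1))"
      by (simp add: algebra_simps t_power_mult t_power_0)
    then show ?thesis using nat[of "nat (- k)"] by simp
  qed
qed

section \<open>Twisted Fox derivatives\<close>

text \<open>An entry of the twisted map is linear in its argument; this isolates the extension of a function
  from group elements to the group ring, so that Fox identities can be pushed through entrywise.\<close>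
definition linear_ext :: "('g \<Rightarrow> 'a::comm_ring_1) \<Rightarrow> ('g \<Rightarrow>\<^sub>0 int) \<Rightarrow> 'a" where
  "linear_ext f a = (\<Sum>g\<in>Poly_Mapping.keys a. of_int (Poly_Mapping.lookup a g) * f g)"

lemma linear_ext_superset:
  assumes "finite K" "Poly_Mapping.keys a \<subseteq> K"
  shows "linear_ext f a = (\<Sum>g\<in>K. of_int (Poly_Mapping.lookup a g) * f g)"
  unfolding linear_ext_def using assms
  by (intro sum.mono_neutral_left) (auto simp: in_keys_iff)

lemma linear_ext_0 [simp]: "linear_ext f 0 = 0"
  by (simp add: linear_ext_def)

lemma linear_ext_frag_of [simp]: "linear_ext f (frag_of g) = f g"
  by (simp add: linear_ext_def)

lemma linear_ext_diff: "linear_ext f (a - b) = linear_ext f a - linear_ext f b"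
proof -
  let ?K = "Poly_Mapping.keys a \<union> Poly_Mapping.keys b"
  have "linear_ext f c = (\<Sum>g\<in>?K. of_int (Poly_Mapping.lookup c g) * f g)"
    if "c \<in> {a, b, a - b}" for c
    using that keys_diff[of a b] by (intro linear_ext_superset) auto
  then show ?thesis
    by (simp add: lookup_minus left_diff_distrib sum_subtractf)
qed

lemma linear_ext_minus: "linear_ext f (- a) = - linear_ext f a"
  using linear_ext_diff[of f 0 a] by simp

lemma linear_ext_add: "linear_ext f (a + b) = linear_ext f a + linear_ext f b"
  using linear_ext_diff[of f a "- b"] by (simp add: linear_ext_minus)

lemma linear_ext_frag_extend:
  "linear_ext f (frag_extend (\<lambda>w. frag_of (h w)) a) = linear_ext (\<lambda>w. f (h w)) a"
  by (induction a rule: frag_induction[OF subset_UNIV])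
    (auto simp: frag_extend_diff linear_ext_diff)

lemma linear_ext_cong:
  assumes "\<And>w. w \<in> Poly_Mapping.keys a \<Longrightarrow> f w = g w"
  shows "linear_ext f a = linear_ext g a"
  unfolding linear_ext_def by (intro sum.cong) (auto simp: assms)

lemma linear_ext_lincomb:
  "linear_ext (\<lambda>w. x * f w + y * g w) a = x * linear_ext f a + y * linear_ext g a"
  by (simp add: linear_ext_def distrib_left sum.distrib sum_distrib_left mult.left_commute)

text \<open>The setting of a twisted Alexander matrix for an arbitrary presentation. The homomorphisms are
  given on the presented group but are used on words, as \<open>deg\<close>, \<open>rep\<close> and their product \<open>twist\<close>.\<close>
locale twisted_presentation =
  fixes S :: "'a set" and R :: "'a letter list set"
    and \<alpha> :: "'a letter list set \<Rightarrow> int" and \<rho> :: "'a letter list set \<Rightarrow> bit mat"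
  assumes relators: "R \<subseteq> carrier (free_group S)"
    and \<alpha>_hom: "\<alpha> \<in> hom (presented_group S R) integer_group"
    and \<rho>_hom: "\<rho> \<in> hom (presented_group S R) SL2"
begin

abbreviation F where "F \<equiv> free_group S"

definition deg :: "'a letter list \<Rightarrow> int" where
  "deg w = \<alpha> (canonical_epi S R w)"

definition rep :: "'a letter list \<Rightarrow> bit mat" where
  "rep w = \<rho> (canonical_epi S R w)"

definition twist :: "'a letter list \<Rightarrow> laurent2 mat" where
  "twist w = t_power (deg w) \<cdot>\<^sub>m map_mat laurent_const (rep w)"

definition twisted_fox :: "'a \<Rightarrow> 'a letter list \<Rightarrow> laurent2 mat" where
  "twisted_fox x w =
     twisted_map \<rho> \<alpha> (frag_extend (\<lambda>w. frag_of (canonical_epi S R w)) (fox_word x w))"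

sublocale F: group F by (rule group_free_group)

sublocale N: normal "normal_closure F R" F
  using F.normal_closure_normal relators .

lemma canonical_epi_hom: "canonical_epi S R \<in> hom F (presented_group S R)"
  using N.r_coset_hom_Mod unfolding presented_group_def canonical_epi_def .

lemma deg_hom: "deg \<in> hom F integer_group"
  using Group.hom_compose[OF canonical_epi_hom \<alpha>_hom] by (simp add: deg_def[abs_def] comp_def)

lemma rep_hom: "rep \<in> hom F SL2"
  using Group.hom_compose[OF canonical_epi_hom \<rho>_hom] by (simp add: rep_def[abs_def] comp_def)

sublocale deg: group_hom F integer_group deg
  using deg_hom by (simp add: group_hom_def group_hom_axioms_def group_integer_group F.is_group)

sublocale rep: group_hom F SL2 rep
  using rep_hom by (simp add: group_hom_def group_hom_axioms_def group_SL2 F.is_group)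

lemma deg_mult: "u \<in> carrier F \<Longrightarrow> v \<in> carrier F \<Longrightarrow> deg (u \<otimes>\<^bsub>F\<^esub> v) = deg u + deg v"
  by simp

lemma rep_mult: "u \<in> carrier F \<Longrightarrow> v \<in> carrier F \<Longrightarrow> rep (u \<otimes>\<^bsub>F\<^esub> v) = rep u * rep v"
  by (simp add: SL2_simps)

lemma deg_one: "deg [] = 0" and rep_one: "rep [] = 1\<^sub>m 2"
  using deg.hom_one rep.hom_one by (simp_all add: SL2_simps free_group_simps)

lemma rep_carrier: "w \<in> carrier F \<Longrightarrow> rep w \<in> carrier_mat 2 2"
  using rep.hom_closed[of w] by (simp add: SL2_simps)

lemma relator_trivial:
  assumes "r \<in> R"
  shows "deg r = 0" "rep r = 1\<^sub>m 2"
proof -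
  have r: "r \<in> carrier F" using relators assms by auto
  have "r \<in> normal_closure F R"
    unfolding normal_closure_def
    by (rule generate.incl) (use r assms in \<open>force intro: exI[of _ "\<one>\<^bsub>F\<^esub>"]\<close>)
  then have "canonical_epi S R r = canonical_epi S R []"
    unfolding canonical_epi_def
    using F.coset_join2[OF r N.is_subgroup] F.coset_join2[OF F.one_closed N.is_subgroup]
    by (simp add: N.one_closed flip: free_group_simps(3)[of S])
  then have "deg r = deg []" "rep r = rep []" by (simp_all add: deg_def rep_def)
  then show "deg r = 0" "rep r = 1\<^sub>m 2" by (simp_all add: deg_one rep_one)
qed

lemma twist_carrier [simp]: "w \<in> carrier F \<Longrightarrow> twist w \<in> carrier_mat 2 2"
  by (simp add: twist_def rep_carrier)

lemma twist_index:
  "w \<in> carrier F \<Longrightarrow> i < 2 \<Longrightarrow> j < 2 \<Longrightarrow>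
    twist w $$ (i, j) = t_power (deg w) * laurent_const (rep w $$ (i, j))"
  using rep_carrier[of w] by (simp add: twist_def)

lemma twist_one: "twist [] = 1\<^sub>m 2"
  by (rule mat2_eqI) (auto simp: twist_def deg_one rep_one t_power_0)

lemma twist_mult:
  assumes "u \<in> carrier F" "v \<in> carrier F"
  shows "twist (u \<otimes>\<^bsub>F\<^esub> v) = twist u * twist v"
proof -
  obtain a b c d a' b' c' d' where entries: "rep u = mat2 a b c d" "rep v = mat2 a' b' c' d'"
    using rep_carrier[OF assms(1)] rep_carrier[OF assms(2)] mat2_exhaust by metis
  have scaled: "t_power k \<cdot>\<^sub>m map_mat laurent_const (mat2 a b c d) =
      mat2 (t_power k * laurent_const a) (t_power k * laurent_const b)
        (t_power k * laurent_const c) (t_power k * laurent_const d)" for k a b c d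
    by (rule mat2_eqI) (auto simp: mat_of_rows_list_def)
  show ?thesis
    unfolding twist_def rep_mult[OF assms] deg_mult[OF assms] entries mat2_times scaled
    unfolding laurent_const_add laurent_const_mult t_power_mult[symmetric]
    by (simp add: algebra_simps)
qed

lemma twisted_fox_alt:
  "twisted_fox x w = mat 2 2 (\<lambda>ij. linear_ext (\<lambda>w. twist w $$ ij) (fox_word x w))"
proof -
  have "twisted_fox x w = mat 2 2 (\<lambda>ij. linear_ext
      (\<lambda>g. (t_power (\<alpha> g) \<cdot>\<^sub>m map_mat laurent_const (\<rho> g)) $$ ij)
      (frag_extend (\<lambda>w. frag_of (canonical_epi S R w)) (fox_word x w)))"
    by (simp add: twisted_fox_def twisted_map_def linear_ext_def case_prod_beta' cong: sum.cong)
  then show ?thesis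
    unfolding linear_ext_frag_extend by (simp add: twist_def deg_def rep_def)
qed

lemma twisted_fox_carrier [simp]: "twisted_fox x w \<in> carrier_mat 2 2"
  by (simp add: twisted_fox_alt)

lemma linear_ext_left_mult:
  assumes "u \<in> carrier F" "Poly_Mapping.keys p \<subseteq> carrier F" "i < 2" "j < 2"
  shows "linear_ext (\<lambda>w. twist w $$ (i, j)) (left_mult u p) =
    twist u $$ (i, 0) * linear_ext (\<lambda>w. twist w $$ (0, j)) p +
    twist u $$ (i, 1) * linear_ext (\<lambda>w. twist w $$ (1, j)) p"
proof -
  have "twist (foldr cons_red u w) $$ (i, j) =
      twist u $$ (i, 0) * twist w $$ (0, j) + twist u $$ (i, 1) * twist w $$ (1, j)"
    if "w \<in> Poly_Mapping.keys p" for w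
  proof -
    have w: "w \<in> carrier F" using that assms(2) by blast
    show ?thesis
      using twist_mult[OF assms(1) w] twist_carrier[OF assms(1)] twist_carrier[OF w] assms(3,4)
      by (simp add: free_group_simps(2) scalar_prod_def sum_upto_2)
  qed
  then show ?thesis
    unfolding left_mult_def linear_ext_frag_extend
    by (simp add: linear_ext_lincomb[symmetric] cong: linear_ext_cong)
qed

text \<open>The product rule survives because \<open>twist\<close> is multiplicative, so that left multiplication by a
  word becomes multiplication by a matrix.\<close>
lemma twisted_fox_mult:
  assumes u: "u \<in> carrier F" and v: "v \<in> carrier F"
  shows "twisted_fox x (u \<otimes>\<^bsub>F\<^esub> v) = twisted_fox x u + twist u * twisted_fox x v"
proof -
  have "fox_word x (u \<otimes>\<^bsub>F\<^esub> v) = fox_word x u + left_mult u (fox_word x v)"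
    using u v fox_word_mult by (auto simp: free_group_simps)
  moreover have "Poly_Mapping.keys (fox_word x v) \<subseteq> carrier F"
    using v by (intro fox_word_keys) (auto simp: free_group_simps)
  ultimately show ?thesis
    using twist_carrier[OF u]
    by (intro mat2_eqI)
      (auto simp: twisted_fox_alt linear_ext_add linear_ext_left_mult[OF u] scalar_prod_def
        sum_upto_2)
qed

text \<open>From \<open>\<partial>(y z y\<inverse>) = \<partial>y + y \<partial>z - (y z y\<inverse>) \<partial>y\<close>. The hypothesis \<open>y \<noteq> z\<close> makes the word
  \<open>y z y\<inverse>\<close> reduced, so that the recursion for Fox derivatives along words applies to it.\<close>
lemma twisted_fox_conj:
  assumes "y \<in> S" "z \<in> S" "y \<noteq> z"
  defines "c \<equiv> free_gen y \<otimes>\<^bsub>F\<^esub> free_gen z \<otimes>\<^bsub>F\<^esub> inv\<^bsub>F\<^esub> free_gen y"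
  shows "twisted_fox x c =
    (if x = y then 1\<^sub>m 2 - twist c else if x = z then twist (free_gen y) else 0\<^sub>m 2 2)"
proof -
  have "inv\<^bsub>F\<^esub> free_gen y = [(y, False)]"
    using assms(1)
    by (intro F.inv_equality)
      (auto simp: free_group_simps free_gen_def reduced_Cons cons_red_def letter_inv_def)
  then have c: "c = [(y, True), (z, True), (y, False)]"
    using assms(3) by (auto simp: c_def free_group_simps free_gen_def cons_red_def letter_inv_def)
  have "fox_word x c =
      (if x = y then frag_of [] - frag_of c else if x = z then frag_of (free_gen y) else 0)"
    using assms(3)
    by (auto simp: c fox_letter_def free_gen_def left_mult_minus left_mult_add cons_red_def
      letter_inv_def)
  moreover have "c \<in> carrier F" "free_gen y \<in> carrier F"
    using assms by (auto simp: free_gen_in_carrier)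
  ultimately show ?thesis
    by (intro mat2_eqI)
      (auto simp: twisted_fox_alt linear_ext_diff twist_one
        intro: minus_carrier_mat dest: twist_carrier)
qed

text \<open>The letters of a word determine its derivative, so any map with the characteristic properties
  of a Fox derivative follows the recursion of \<^const>\<open>fox_word\<close>.\<close>
lemma fox_derivative_frag_of:
  assumes "w \<in> carrier F"
  shows "fox_derivative S x (frag_of w) = fox_word x w"
proof -
  define D where "D = fox_derivative S x"
  have D: "is_fox_derivative S x D"
    unfolding D_def fox_derivative_def by (rule theI'[OF fox_derivative_ex1])
  have mult: "D (frag_of (foldr cons_red u v)) = D (frag_of u) + left_mult u (D (frag_of v))"
    if "u \<in> carrier F" "v \<in> carrier F" for u v
    using D that
    unfolding is_fox_derivative_def Let_def frag_of_mult_free int_group_ring_simps free_group_simps(2)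
    by blast
  have nil: "D (frag_of []) = 0"
    using mult[of "[]" "[]"] by (simp add: free_group_simps)
  have gen: "D (frag_of [(y, True)]) = fox_letter x (y, True)" if "y \<in> S" for y
    using D that
    by (auto simp: is_fox_derivative_def Let_def int_group_ring_simps free_gen_def
      free_group_simps fox_letter_def)
  have letter: "D (frag_of [a]) = fox_letter x a" if "fst a \<in> S" for a
  proof (cases "snd a")
    case True
    then show ?thesis using gen[OF that] by (cases a) simp
  next
    case False
    then obtain y where a: "a = (y, False)" by (cases a) auto
    have "0 = D (frag_of [a]) + left_mult [a] (fox_letter x (y, True))"
      using mult[of "[(y, False)]" "[(y, True)]"] gen[of y] that nil
      by (simp add: a free_group_simps reduced_Cons cons_red_def letter_inv_def)
    then show ?thesis
      by (auto simp: a fox_letter_def cons_red_def eq_neg_iff_add_eq_0)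
  qed
  have "D (frag_of w) = fox_word x w"
    using assms
  proof (induction w)
    case (Cons a w)
    then have "[a] \<in> carrier F" "w \<in> carrier F" "fst a \<in> S" "reduced (a # w)"
      by (auto simp: free_group_simps reduced_Cons)
    then show ?case
      using mult[of "[a]" w] letter[of a] Cons.IH by (simp add: cons_red_reduced)
  qed (simp add: nil)
  then show ?thesis by (simp add: D_def)
qed

text \<open>The adjugate formula; signs disappear over the two-element field.\<close>
lemma rep_inv_mat2:
  assumes u: "u \<in> carrier F" and "rep u = mat2 a b c d"
  shows "rep (inv\<^bsub>F\<^esub> u) = mat2 d b c a"
proof -
  have "rep u \<in> carrier SL2" using u by simp
  moreover have "mat2 d b c a * mat2 a b c d = 1\<^sub>m 2" "det (mat2 d b c a) = 1"
    if "det (mat2 a b c d) = 1"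
    using that unfolding det_mat2 mat2_simps
    by (cases a; cases b; cases c; cases d; simp)+
  ultimately have "inv\<^bsub>SL2\<^esub> rep u = mat2 d b c a"
    unfolding assms(2)
    by (intro group.inv_equality[OF group_SL2]) (auto simp: SL2_simps)
  then show ?thesis using rep.hom_inv[OF u] by simp
qed

end

section \<open>The Alexander matrix of the theta-n group\<close>

\<comment> \<open>Generators are numbered from 1; the index 1 is kept in that form throughout.\<close>
declare One_nat_def [simp del]

definition theta_factor :: "nat \<Rightarrow> nat \<Rightarrow> nat letter list" where
  "theta_factor n i =
     (let F = free_group {1..n}; x = free_gen in
      x i \<otimes>\<^bsub>F\<^esub> x (if i = 1 then n else i - 1) \<otimes>\<^bsub>F\<^esub> inv\<^bsub>F\<^esub> x i)"

text \<open>Products of the factors of the relator over arbitrary index lists, so that the relator can be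
  split at the factors in which a given generator occurs.\<close>
definition theta_word :: "nat \<Rightarrow> nat list \<Rightarrow> nat letter list" where
  "theta_word n js =
     foldr (\<lambda>i w. theta_factor n i \<otimes>\<^bsub>free_group {1..n}\<^esub> w) js \<one>\<^bsub>free_group {1..n}\<^esub>"

lemma theta_relator_eq: "theta_relator n = theta_word n [1..<n + 1]"
  by (simp add: theta_relator_def theta_word_def theta_factor_def Let_def)

lemma theta_word_Nil: "theta_word n [] = []"
  by (simp add: theta_word_def free_group_simps)

lemma theta_word_Cons:
  "theta_word n (i # is) = theta_factor n i \<otimes>\<^bsub>free_group {1..n}\<^esub> theta_word n is"
  by (simp add: theta_word_def)

lemma theta_factor_carrier: "i \<in> {1..n} \<Longrightarrow> theta_factor n i \<in> carrier (free_group {1..n})"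
proof -
  interpret F: group "free_group {1..n}" by (rule group_free_group)
  assume "i \<in> {1..n}"
  moreover from this have "(if i = 1 then n else i - 1) \<in> {1..n}" by auto
  ultimately show ?thesis unfolding theta_factor_def Let_def
    by (intro F.m_closed F.inv_closed free_gen_in_carrier)
qed

lemma theta_word_carrier: "set is \<subseteq> {1..n} \<Longrightarrow> theta_word n is \<in> carrier (free_group {1..n})"
proof -
  interpret F: group "free_group {1..n}" by (rule group_free_group)
  show "set is \<subseteq> {1..n} \<Longrightarrow> theta_word n is \<in> carrier (free_group {1..n})"
    by (induction "is") (auto simp: theta_word_def intro!: theta_factor_carrier)
qed

lemma theta_word_append:
  assumes "set is \<subseteq> {1..n}" "set js \<subseteq> {1..n}"
  shows "theta_word n (is @ js) = theta_word n is \<otimes>\<^bsub>free_group {1..n}\<^esub> theta_word n js"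
proof -
  interpret F: group "free_group {1..n}" by (rule group_free_group)
  show ?thesis
    using assms(1)
  proof (induction "is")
    case Nil
    then show ?case using theta_word_carrier[OF assms(2)] F.l_one
      by (simp add: theta_word_Nil free_group_simps)
  next
    case (Cons i "is")
    then show ?case
      using theta_word_carrier[of "is" n] theta_word_carrier[OF assms(2)] theta_factor_carrier[of i n]
      by (simp add: theta_word_Cons F.m_assoc)
  qed
qed

locale theta_twist =
  fixes n :: nat and \<alpha> :: "nat letter list set \<Rightarrow> int" and \<rho> :: "nat letter list set \<Rightarrow> bit mat"
  assumes n_ge_3: "n \<ge> 3"
    and \<alpha>_theta: "\<alpha> \<in> hom (theta_group n) integer_group"
    and \<rho>_theta: "\<rho> \<in> hom (theta_group n) SL2"
begin

sublocale twisted_presentation "{1..n}" "{theta_relator n}" \<alpha> \<rho>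
  using \<alpha>_theta \<rho>_theta
  by unfold_locales (auto simp: theta_relator_eq theta_group_def intro!: theta_word_carrier)

abbreviation gen :: "nat \<Rightarrow> nat letter list" where
  "gen i \<equiv> free_gen i"

definition prefix :: "nat \<Rightarrow> nat letter list" where
  "prefix j = theta_word n [1..<j]"

definition next_index :: "nat \<Rightarrow> nat" where
  "next_index j = (if j = n then 1 else j + 1)"

lemma next_index_range: "j \<in> {1..n} \<Longrightarrow> next_index j \<in> {1..n}"
  by (auto simp: next_index_def)

lemma gen_carrier: "i \<in> {1..n} \<Longrightarrow> gen i \<in> carrier F"
  by (rule free_gen_in_carrier)

lemma prefix_carrier: "j \<le> n + 1 \<Longrightarrow> prefix j \<in> carrier F"
  unfolding prefix_def by (intro theta_word_carrier) auto

lemma prefix_1: "prefix (Suc 0) = []"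
  by (simp add: prefix_def theta_word_Nil)

lemma prefix_Suc:
  assumes "j \<in> {1..n}"
  shows "prefix (j + 1) = prefix j \<otimes>\<^bsub>F\<^esub> theta_factor n j"
proof -
  have "[1..<j + 1] = [1..<j] @ [j]" using assms upt_add_eq_append[of 1 j 1] by (simp add: upt_conv_Cons)
  then show ?thesis
    using assms theta_factor_carrier[OF assms] F.r_one[of "theta_factor n j"]
    unfolding prefix_def
    by (simp add: theta_word_append[of "[1..<j]" n "[j]"] subset_iff theta_word_Cons
      theta_word_Nil free_group_simps(3))
qed

lemma prefix_last: "prefix (n + 1) = theta_relator n"
  by (simp add: prefix_def theta_relator_eq)

lemma twisted_fox_factor:
  assumes "i \<in> {1..n}" "j \<in> {1..n}"
  shows "twisted_fox j (theta_factor n i) =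
    (if j = i then 1\<^sub>m 2 - twist (theta_factor n i)
     else if i = next_index j then twist (gen i) else 0\<^sub>m 2 2)"
proof -
  let ?p = "if i = 1 then n else i - 1"
  have p: "?p \<in> {1..n}" "i \<noteq> ?p" using assms n_ge_3 by auto
  have "j = ?p \<longleftrightarrow> i = next_index j"
    using assms by (auto simp: next_index_def)
  then show ?thesis
    using twisted_fox_conj[OF assms(1) p, of j] unfolding theta_factor_def Let_def by simp
qed

lemma twisted_fox_theta_word_eq_0:
  assumes "j \<in> {1..n}" "set is \<subseteq> {1..n} - {j, next_index j}"
  shows "twisted_fox j (theta_word n is) = 0\<^sub>m 2 2"
  using assms(2)
proof (induction "is")
  case Nil
  show ?case by (intro mat2_eqI) (auto simp: theta_word_Nil twisted_fox_alt)
next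
  case (Cons i "is")
  then have i: "i \<in> {1..n}" "set is \<subseteq> {1..n}" by auto
  then show ?case
    using Cons twisted_fox_factor[OF i(1) assms(1)]
      right_mult_zero_mat[OF twist_carrier[OF theta_factor_carrier[OF i(1)]]]
    by (auto simp: theta_word_Cons twisted_fox_mult theta_factor_carrier theta_word_carrier)
qed

text \<open>Only the factors with index \<open>j\<close> and \<open>next_index j\<close> involve the generator \<open>j\<close>. They are adjacent for
  \<open>j < n\<close>. For \<open>j = n\<close> they are the last and the first factor of the relator; the formula keeps its
  form because \<open>prefix (n + 1)\<close>, the relator, acts as the identity.\<close>
lemma twisted_fox_relator:
  assumes j: "j \<in> {1..n}"
  shows "twisted_fox j (theta_relator n) =
    twist (prefix j) - twist (prefix (j + 1)) + twist (prefix (j + 1)) * twist (gen (next_index j))"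
proof -
  let ?w = "theta_word n" and ?c = "theta_factor n"
  note carriers = theta_factor_carrier theta_word_carrier gen_carrier prefix_carrier
  have expand: "P * (1\<^sub>m 2 - C + C * X) = P - P * C + P * C * X"
    if PCX: "P \<in> carrier_mat 2 2" "C \<in> carrier_mat 2 2" "X \<in> carrier_mat 2 2"
    for P C X :: "laurent2 mat"
  proof -
    obtain p p' p'' p''' c c' c'' c''' x x' x'' x''' where
      "P = mat2 p p' p'' p'''" "C = mat2 c c' c'' c'''" "X = mat2 x x' x'' x'''"
      using PCX mat2_exhaust by metis
    then show ?thesis by (simp add: mat2_simps algebra_simps)
  qed
  have step: "twist (prefix (j + 1)) = twist (prefix j) * twist (?c j)"
    using j prefix_Suc[OF j] carriers by (simp add: twist_mult)
  show ?thesis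
  proof (cases "j = n")
    case False
    let ?rest = "?w [j + 2..<n + 1]"
    have j': "j + 1 \<in> {1..n}" "next_index j = j + 1" using j False by (auto simp: next_index_def)
    have split: "[1..<n + 1] = [1..<j] @ j # (j + 1) # [j + 2..<n + 1]"
      using j False upt_add_eq_append[of 1 j "n + 1 - j"] by (simp add: upt_conv_Cons)
    have eq: "theta_relator n = prefix j \<otimes>\<^bsub>F\<^esub> (?c j \<otimes>\<^bsub>F\<^esub> (?c (j + 1) \<otimes>\<^bsub>F\<^esub> ?rest))"
      unfolding theta_relator_eq prefix_def split using j False
      by (subst theta_word_append) (auto simp: theta_word_Cons)
    have "twisted_fox j (prefix j) = 0\<^sub>m 2 2" "twisted_fox j ?rest = 0\<^sub>m 2 2"
      unfolding prefix_def using j j' by (auto intro!: twisted_fox_theta_word_eq_0)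
    moreover have "?rest \<in> carrier F" by (rule carriers) auto
    ultimately have "twisted_fox j (theta_relator n) =
        0\<^sub>m 2 2 + twist (prefix j) * (1\<^sub>m 2 - twist (?c j) +
          twist (?c j) * (twist (gen (j + 1)) + twist (?c (j + 1)) * 0\<^sub>m 2 2))"
      using j j' carriers(1)[of j n] carriers(1)[of "j + 1" n] carriers(4)[of j]
      by (intro trans[OF arg_cong[OF eq, of "twisted_fox j"]])
        (simp add: twisted_fox_mult twisted_fox_factor)
    also have "\<dots> = twist (prefix j) * (1\<^sub>m 2 - twist (?c j) + twist (?c j) * twist (gen (j + 1)))"
    proof -
      have "0\<^sub>m 2 2 + P * (1\<^sub>m 2 - C + C * (X + C' * 0\<^sub>m 2 2)) = P * (1\<^sub>m 2 - C + C * X)"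
        if "P \<in> carrier_mat 2 2" "C \<in> carrier_mat 2 2" "X \<in> carrier_mat 2 2" "C' \<in> carrier_mat 2 2"
        for P C X C' :: "laurent2 mat"
        using that
        by (simp add: right_mult_zero_mat[of C' 2 2 2] right_add_zero_mat[of X 2 2]
          left_add_zero_mat[of _ 2 2] minus_carrier_mat mult_carrier_mat[of _ 2 2])
      then show ?thesis
        by (rule, use j j' in \<open>auto intro!: twist_carrier carriers\<close>)
    qed
    finally show ?thesis
      unfolding step j'(2)
      by (rule trans[OF _ expand]) (use j j' in \<open>auto intro!: twist_carrier carriers\<close>)
  next
    case True
    let ?mid = "?w [2..<n]"
    have n1: "1 \<in> {1..n}" "n \<in> {1..n}" "next_index n = 1" using n_ge_3 by (auto simp: next_index_def)
    have "prefix n = ?c 1 \<otimes>\<^bsub>F\<^esub> ?mid"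
      using n_ge_3 by (simp add: prefix_def upt_conv_Cons theta_word_Cons numeral_2_eq_2)
    moreover have "theta_word n [1..<n + 1] = prefix n \<otimes>\<^bsub>F\<^esub> ?c n"
      using prefix_Suc[OF n1(2)] by (simp add: prefix_def)
    moreover have "twisted_fox n ?mid = 0\<^sub>m 2 2"
      using n1 by (auto intro!: twisted_fox_theta_word_eq_0)
    moreover have "?mid \<in> carrier F" by (rule carriers) auto
    ultimately have "twisted_fox n (theta_word n [1..<n + 1]) =
        twist (gen 1) + twist (prefix n) * (1\<^sub>m 2 - twist (?c n))"
      using n1 n_ge_3 carriers(1)[of 1 n] carriers(1)[of n n] carriers(4)[of n]
        right_mult_zero_mat[OF twist_carrier[OF carriers(1)[of 1 n]]]
        right_add_zero_mat[OF twist_carrier[OF carriers(3)[of 1]]]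
      by (simp add: twisted_fox_mult twisted_fox_factor)
    then have relator: "twisted_fox n (theta_relator n) =
        twist (gen 1) + twist (prefix n) * (1\<^sub>m 2 - twist (?c n))"
      by (simp only: theta_relator_eq[symmetric])
    have "twist (prefix (n + 1)) = 1\<^sub>m 2"
      using relator_trivial[of "theta_relator n"] prefix_last
      by (simp add: twist_def t_power_0) (rule mat2_eqI; simp)
    then have inverse: "twist (prefix n) * twist (?c n) = 1\<^sub>m 2" using step True by simp
    have combine: "X + P * (1\<^sub>m 2 - C) = P - P * C + P * C * X"
      if "P \<in> carrier_mat 2 2" "C \<in> carrier_mat 2 2" "X \<in> carrier_mat 2 2"
        and "P * C = 1\<^sub>m 2" for P C X :: "laurent2 mat"
    proof -
      have "P * (1\<^sub>m 2 - C) = P - 1\<^sub>m 2"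
        using mult_minus_distrib_mat[OF that(1) one_carrier_mat that(2)] that by simp
      then show ?thesis
        using that comm_add_mat[of X 2 2 "P - 1\<^sub>m 2"] by (simp add: minus_carrier_mat)
    qed
    show ?thesis
      unfolding step unfolding True n1(3) relator
      by (rule combine) (use n1 inverse in \<open>auto intro!: twist_carrier carriers\<close>)
  qed
qed

lemma twisted_alexander_matrix_entry:
  assumes "j \<in> {1..n}" "i < 2" "e < 2"
  shows "twisted_alexander_matrix n (theta_relator n) \<rho> \<alpha> i (2 * (j - 1) + e) =
    twist (prefix j) $$ (i, e) - twist (prefix (j + 1)) $$ (i, e) +
    twist (prefix (j + 1) \<otimes>\<^bsub>F\<^esub> gen (next_index j)) $$ (i, e)"
proof -
  have carriers: "prefix j \<in> carrier F" "prefix (j + 1) \<in> carrier F"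
    "gen (next_index j) \<in> carrier F"
    using assms(1) next_index_range[OF assms(1)] by (auto intro!: prefix_carrier gen_carrier)
  have "theta_relator n \<in> carrier F" using relators by simp
  moreover have "2 * (j - 1) + e < 2 * n" "(2 * (j - 1) + e) div 2 + 1 = j" "(2 * (j - 1) + e) mod 2 = e"
    using assms by auto
  ultimately have "twisted_alexander_matrix n (theta_relator n) \<rho> \<alpha> i (2 * (j - 1) + e) =
      twisted_fox j (theta_relator n) $$ (i, e)"
    using assms(2) by (simp add: twisted_alexander_matrix_def twisted_fox_def fox_derivative_frag_of)
  then show ?thesis
    using diff_add_index[OF carriers(1,2)[THEN twist_carrier]
        twist_carrier[OF F.m_closed[OF carriers(2,3)]] assms(2,3)]
    by (simp only: twisted_fox_relator[OF assms(1)] twist_mult[OF carriers(2,3)])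
qed

text \<open>Every entry of \<open>twist w\<close> is congruent to the corresponding entry of \<open>rep w\<close> modulo \<open>1 + t\<close>, so a
  block may be reduced to a sum of values of \<open>\<rho>\<close>.\<close>
lemma one_plus_t_dvd_entry:
  assumes j: "j \<in> {1..n}" and ie: "i < 2" "e < 2"
    and zero: "(rep (prefix j) - rep (prefix (j + 1)) +
      rep (prefix (j + 1)) * rep (gen (next_index j))) $$ (i, e) = 0"
  shows "1 + t_power 1 dvd twisted_alexander_matrix n (theta_relator n) \<rho> \<alpha> i (2 * (j - 1) + e)"
proof -
  have carriers: "prefix j \<in> carrier F" "prefix (j + 1) \<in> carrier F"
    "gen (next_index j) \<in> carrier F"
    using j next_index_range[OF j] by (auto intro!: prefix_carrier gen_carrier)
  let ?u = "prefix j" and ?v = "prefix (j + 1)"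
  let ?w = "?v \<otimes>\<^bsub>F\<^esub> gen (next_index j)"
  let ?const = "\<lambda>w. laurent_const (rep w $$ (i, e))"
  have near: "1 + t_power 1 dvd twist w $$ (i, e) - ?const w" if "w \<in> carrier F" for w
  proof -
    have "twist w $$ (i, e) - ?const w = (t_power (deg w) - 1) * ?const w"
      using twist_index[OF that ie] by (simp add: left_diff_distrib)
    then show ?thesis using one_plus_t_dvd_t_power[of "deg w"] by simp
  qed
  have "?const ?u - ?const ?v + ?const ?w = laurent_const ((rep ?u - rep ?v + rep ?w) $$ (i, e))"
    using diff_add_index[OF carriers(1,2)[THEN rep_carrier]
        rep_carrier[OF F.m_closed[OF carriers(2,3)]] ie]
    by (simp only: laurent_const_add laurent_const_diff)
  also have "\<dots> = 0"
    using zero by (simp only: rep_mult[OF carriers(2,3)] laurent_const_0)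
  finally have "twist ?u $$ (i, e) - twist ?v $$ (i, e) + twist ?w $$ (i, e) =
      (twist ?u $$ (i, e) - ?const ?u) - (twist ?v $$ (i, e) - ?const ?v)
      + (twist ?w $$ (i, e) - ?const ?w)"
    by (simp add: algebra_simps)
  then show ?thesis
    unfolding twisted_alexander_matrix_entry[OF j ie]
    using near[OF carriers(1)] near[OF carriers(2)] near[of ?w] carriers
    by (metis F.m_closed dvd_add dvd_diff)
qed

lemma rep_factor:
  assumes "i \<in> {1..n}" "rep (gen i) = mat2 a b c d"
    and "rep (gen (if i = 1 then n else i - 1)) = M"
  shows "rep (theta_factor n i) = mat2 a b c d * M * mat2 d b c a"
proof -
  have "(if i = 1 then n else i - 1) \<in> {1..n}" using assms(1) by auto
  then have "gen (if i = 1 then n else i - 1) \<in> carrier F" "gen i \<in> carrier F"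
    using assms(1) by (auto intro!: gen_carrier)
  then show ?thesis
    unfolding theta_factor_def Let_def
    by (simp only: rep_mult rep_inv_mat2[OF _ assms(2)] assms(2,3) F.m_closed F.inv_closed)
qed

lemma deg_factor:
  assumes "i \<in> {1..n}"
  shows "deg (theta_factor n i) = deg (gen (if i = 1 then n else i - 1))"
proof -
  have "(if i = 1 then n else i - 1) \<in> {1..n}" using assms(1) by auto
  then have "gen (if i = 1 then n else i - 1) \<in> carrier F" "gen i \<in> carrier F"
    using assms(1) by (auto intro!: gen_carrier)
  then show ?thesis
    unfolding theta_factor_def Let_def by (simp add: deg.hom_inv)
qed

lemma rep_prefix_Suc:
  assumes "j \<in> {1..n}"
  shows "rep (prefix (j + 1)) = rep (prefix j) * rep (theta_factor n j)"
  using assms rep_mult[of "prefix j" "theta_factor n j"] prefix_carrier[of j]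
    theta_factor_carrier[OF assms] by (simp add: prefix_Suc)

text \<open>Prefixes are computed from the right end, starting with the trivial value of the relator:
  this avoids multiplying out the long run of equal factors, whose length depends on \<open>n\<close>.\<close>
lemma rep_prefix_pred:
  assumes i: "i \<in> {2..n}" and "rep (gen i) = mat2 a b c d" "rep (gen (i - 1)) = mat2 a' b' c' d'"
  shows "rep (prefix i) =
    rep (prefix (i + 1)) * (mat2 a b c d * mat2 d' b' c' a' * mat2 d b c a)"
proof -
  have gens: "gen i \<in> carrier F" "gen (i - 1) \<in> carrier F"
    using i by (auto intro!: gen_carrier)
  have i': "i \<in> {1..n}" using i by auto
  have P: "prefix i \<in> carrier F" "prefix (i + 1) \<in> carrier F" "theta_factor n i \<in> carrier F"
    using i by (auto intro!: prefix_carrier theta_factor_carrier)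
  have "inv\<^bsub>F\<^esub> theta_factor n i = gen i \<otimes>\<^bsub>F\<^esub> inv\<^bsub>F\<^esub> gen (i - 1) \<otimes>\<^bsub>F\<^esub> inv\<^bsub>F\<^esub> gen i"
    using gens i by (simp add: theta_factor_def Let_def F.inv_mult_group F.m_assoc)
  moreover have "prefix i = prefix (i + 1) \<otimes>\<^bsub>F\<^esub> inv\<^bsub>F\<^esub> theta_factor n i"
    using P unfolding prefix_Suc[OF i'] by (simp add: F.m_assoc)
  ultimately show ?thesis
    using gens P(2)
    by (simp only: rep_mult F.m_closed F.inv_closed assms(2,3) rep_inv_mat2[OF _ assms(2)]
      rep_inv_mat2[OF _ assms(3)])
qed

lemma rep_prefix_last: "rep (prefix (n + 1)) = 1\<^sub>m 2"
  using relator_trivial(2)[of "theta_relator n"] by (simp add: prefix_last)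

lemma deg_prefix_Suc:
  assumes "j \<in> {1..n}"
  shows "deg (prefix (j + 1)) = deg (prefix j) + deg (theta_factor n j)"
  using assms deg_mult[of "prefix j" "theta_factor n j"] prefix_carrier[of j]
    theta_factor_carrier[OF assms] by (simp add: prefix_Suc)

text \<open>The group \<open>SL(2; \<int>/2)\<close> is the symmetric group on three letters: \<open>A\<close> has order 3, and \<open>B\<close>, \<open>C\<close>, \<open>D\<close>
  are the three involutions.\<close>
abbreviation A :: "bit mat" where "A \<equiv> mat2 0 1 1 1"
abbreviation B :: "bit mat" where "B \<equiv> mat2 0 1 1 0"
abbreviation C :: "bit mat" where "C \<equiv> mat2 1 0 1 1"
abbreviation D :: "bit mat" where "D \<equiv> mat2 1 1 0 1"

end

section \<open>Reduction at \<open>t = 1\<close> and two explicit columns\<close>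

text \<open>Both congruence classes of \<open>n\<close> are described by counting from the end, which makes the exceptional
  indices independent of the quotient of \<open>n\<close> by 6.\<close>
locale theta_rep = theta_twist +
  assumes deg_gen: "\<And>i. i \<in> {1..n - 1} \<Longrightarrow> deg (gen i) = 1"
    and deg_gen_last: "deg (gen n) = 1 - int n"
    and rep_cases:
      "n \<ge> 5 \<and> (\<forall>i\<in>{1..n - 2}. rep (gen i) = A) \<and> rep (gen (n - 1)) = B \<and> rep (gen n) = C \<or>
       n \<ge> 7 \<and> (\<forall>i\<in>{1..n - 4}. rep (gen i) = A) \<and> rep (gen (n - 3)) = B \<and> rep (gen (n - 2)) = C \<and>
         rep (gen (n - 1)) = B \<and> rep (gen n) = C"
begin

text \<open>The reduction at \<open>t = 1\<close> of the block of generator \<open>j\<close>.\<close>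
abbreviation fox_sum :: "nat \<Rightarrow> bit mat" where
  "fox_sum j \<equiv> rep (prefix j) - rep (prefix (j + 1)) + rep (prefix (j + 1)) * rep (gen (next_index j))"

lemma n_ge_5: "n \<ge> 5"
  using rep_cases by auto

lemma rep_gens:
  "rep (gen 1) = A" "rep (gen 2) = A" "rep (gen 3) = A" "rep (gen (n - 1)) = B" "rep (gen n) = C"
  using rep_cases by auto

lemma next_index_less: "j < n \<Longrightarrow> next_index j = j + 1"
  by (simp add: next_index_def)

lemma rep_prefix_2: "rep (prefix 2) = B"
  using rep_prefix_Suc[of 1] rep_factor[of 1 0 1 1 1 C] rep_gens n_ge_5 prefix_1
  by (simp add: rep_one mat2_simps One_nat_def[symmetric])

lemma rep_prefix_3: "rep (prefix 3) = D"
  using rep_prefix_Suc[of 2] rep_factor[of 2 0 1 1 1 A] rep_gens n_ge_5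
  by (simp add: rep_prefix_2 mat2_simps One_nat_def[symmetric])

lemma rep_prefix_n: "rep (prefix n) = D"
  using rep_prefix_pred[of n 1 0 1 1 0 1 1 0] rep_gens n_ge_5
  by (simp add: rep_prefix_last mat2_simps)

lemma fox_sum_1_top_row: "e < 2 \<Longrightarrow> fox_sum 1 $$ (0, e) = 0"
  using prefix_1 rep_gens n_ge_5
  by (auto simp: rep_one rep_prefix_2 next_index_less mat2_simps less_2_cases_iff
    One_nat_def[symmetric])

text \<open>Inside the run the block is \<open>\<rho>(P\<^sub>j) (1 + A + A\<^sup>2)\<close>, and \<open>A\<close> satisfies \<open>A\<^sup>2 + A + 1 = 0\<close>.\<close>
lemma fox_sum_run:
  assumes "j \<in> {2..<n}" "rep (gen (j - 1)) = A" "rep (gen j) = A" "rep (gen (j + 1)) = A"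
  shows "fox_sum j = 0\<^sub>m 2 2"
proof -
  have "rep (theta_factor n j) = A"
    using assms rep_factor[of j 0 1 1 1 A] by (simp add: mat2_simps)
  then have "rep (prefix (j + 1)) = rep (prefix j) * A"
    using rep_prefix_Suc[of j] assms(1) by simp
  moreover obtain a b c d where "rep (prefix j) = mat2 a b c d"
    by (rule mat2_exhaust[OF rep_carrier[OF prefix_carrier[of j]]]) (use assms(1) in auto)
  moreover have "next_index j = j + 1" using assms(1) by (simp add: next_index_less)
  ultimately show ?thesis
    using assms(4)
    by (intro mat2_eqI) (cases a; cases b; cases c; cases d; simp add: mat2_simps)+
qed

lemma fox_sum_n_top_row: "e < 2 \<Longrightarrow> fox_sum n $$ (0, e) = 0"
  using rep_prefix_n rep_prefix_last rep_gens
  by (auto simp: next_index_def mat2_simps less_2_cases_iff)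

text \<open>The blocks at both ends do not vanish, but each of them has the row vector \<open>(1, 0)\<close> in its left
  kernel. This is verified block by block with the prefixes found from the right.\<close>
lemma fox_sum_top_row:
  assumes j: "j \<in> {1..n}" and e: "e < 2"
  shows "fox_sum j $$ (0, e) = 0"
proof -
  have index: "n - 1 + 1 = n" "n - 2 + 1 = n - 1"
    "next_index (n - 1) = n" "next_index (n - 2) = n - 1" "n - 1 - 1 = n - 2" "n - 2 - 1 = n - 3"
    "2 \<le> n - 1" "2 \<le> n - 2"
    using n_ge_5 by (auto simp: next_index_def)
  from rep_cases show ?thesis
  proof
    assume *: "n \<ge> 5 \<and> (\<forall>i\<in>{1..n - 2}. rep (gen i) = A) \<and> rep (gen (n - 1)) = B \<and> rep (gen n) = C"
    then have run: "rep (gen i) = A" if "1 \<le> i" "i \<le> n - 2" for i using that by auto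
    have gens: "rep (gen (n - 3)) = A" "rep (gen (n - 2)) = A" using * by (auto intro!: run)
    have p1: "rep (prefix (n - 1)) = C"
      using rep_prefix_pred[of "n - 1" 0 1 1 0 0 1 1 1] * gens index(7)
      by (simp add: index rep_prefix_n mat2_simps)
    have p2: "rep (prefix (n - 2)) = D"
      using rep_prefix_pred[of "n - 2" 0 1 1 1 0 1 1 1] * gens index(8)
      by (simp add: index p1 mat2_simps)
    have "fox_sum (n - 1) $$ (0, e) = 0" "fox_sum (n - 2) $$ (0, e) = 0"
      unfolding index p1 p2 rep_prefix_n using * e
      by (auto simp: mat2_simps less_2_cases_iff)
    moreover have "fox_sum j = 0\<^sub>m 2 2" if "j \<in> {2..<n - 2}"
      using that n_ge_5 by (intro fox_sum_run run) auto
    moreover have "j = 1 \<or> j \<in> {2..<n - 2} \<or> j = n - 2 \<or> j = n - 1 \<or> j = n" using j by auto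
    ultimately show ?thesis
      using fox_sum_1_top_row[OF e] fox_sum_n_top_row[OF e] e by auto
  next
    assume *: "n \<ge> 7 \<and> (\<forall>i\<in>{1..n - 4}. rep (gen i) = A) \<and> rep (gen (n - 3)) = B \<and> rep (gen (n - 2)) = C \<and>
         rep (gen (n - 1)) = B \<and> rep (gen n) = C"
    then have run: "rep (gen i) = A" if "1 \<le> i" "i \<le> n - 4" for i using that by auto
    have gens: "rep (gen (n - 5)) = A" "rep (gen (n - 4)) = A" using * by (auto intro!: run)
    have index': "n - 3 + 1 = n - 2" "n - 4 + 1 = n - 3" "next_index (n - 3) = n - 2"
      "next_index (n - 4) = n - 3" "n - 3 - 1 = n - 4" "n - 4 - 1 = n - 5"
      "2 \<le> n - 3" "2 \<le> n - 4"
      using * by (auto simp: next_index_def)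
    have p1: "rep (prefix (n - 1)) = 1\<^sub>m 2"
      using rep_prefix_pred[of "n - 1" 0 1 1 0 1 0 1 1] *
      by (simp add: index rep_prefix_n mat2_simps)
    have p2: "rep (prefix (n - 2)) = D"
      using rep_prefix_pred[of "n - 2" 1 0 1 1 0 1 1 0] *
      by (simp add: index p1 mat2_simps)
    have p3: "rep (prefix (n - 3)) = C"
      using rep_prefix_pred[of "n - 3" 0 1 1 0 0 1 1 1] * gens index'(7)
      by (simp add: index' p2 mat2_simps)
    have p4: "rep (prefix (n - 4)) = D"
      using rep_prefix_pred[of "n - 4" 0 1 1 1 0 1 1 1] * gens index'(8)
      by (simp add: index' p3 mat2_simps)
    have "fox_sum (n - 1) $$ (0, e) = 0" "fox_sum (n - 2) $$ (0, e) = 0"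
      "fox_sum (n - 3) $$ (0, e) = 0" "fox_sum (n - 4) $$ (0, e) = 0"
      unfolding index index' p1 p2 p3 p4 rep_prefix_n using * e
      by (auto simp: mat2_simps less_2_cases_iff)
    moreover have "fox_sum j = 0\<^sub>m 2 2" if "j \<in> {2..<n - 4}"
      using that n_ge_5 by (intro fox_sum_run run) auto
    moreover have "j = 1 \<or> j \<in> {2..<n - 4} \<or> j = n - 4 \<or> j = n - 3 \<or> j = n - 2 \<or> j = n - 1 \<or> j = n"
      using j by auto
    ultimately show ?thesis
      using fox_sum_1_top_row[OF e] fox_sum_n_top_row[OF e] e by auto
  qed
qed

text \<open>For the generator \<open>x\<^sub>2\<close> the prefixes involve only \<open>x\<^sub>n, x\<^sub>1, x\<^sub>2, x\<^sub>3\<close>, on which the two congruence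
  classes of \<open>n\<close> agree. The relevant index 3 is that of the second column of the second block.\<close>
lemma alexander_second_block:
  "twisted_alexander_matrix n (theta_relator n) \<rho> \<alpha> 0 3 = t_power (1 - int n) * (1 + t_power 1)"
  "twisted_alexander_matrix n (theta_relator n) \<rho> \<alpha> 1 3 =
     t_power (1 - int n) * (t_power 1 + t_power 2)"
proof -
  let ?w = "prefix 3 \<otimes>\<^bsub>F\<^esub> gen 3"
  have carriers: "prefix 2 \<in> carrier F" "prefix 3 \<in> carrier F" "gen 3 \<in> carrier F"
    using n_ge_5 by (auto intro!: prefix_carrier gen_carrier)
  have deg: "deg (prefix 2) = 1 - int n" "deg (prefix 3) = 2 - int n" "deg ?w = 3 - int n"
    using deg_prefix_Suc[of 1] deg_prefix_Suc[of 2] deg_factor[of 1] deg_factor[of 2]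
      deg_gen[of 1] deg_gen[of 3] deg_gen_last n_ge_5 prefix_1 carriers deg_mult[of "prefix 3" "gen 3"]
    by (simp_all add: deg_one One_nat_def[symmetric])
  have "rep ?w = C"
    using rep_mult[of "prefix 3" "gen 3"] carriers rep_prefix_3 rep_gens by (simp add: mat2_simps)
  then have entry: "twisted_alexander_matrix n (theta_relator n) \<rho> \<alpha> i 3 =
      t_power (1 - int n) * laurent_const (B $$ (i, 1)) - t_power (2 - int n) * laurent_const (D $$ (i, 1))
      + t_power (3 - int n) * laurent_const (C $$ (i, 1))" if "i < 2" for i
    using twisted_alexander_matrix_entry[of 2 i 1] that n_ge_5 carriers twist_index[of ?w i 1] deg
    by (simp add: next_index_less twist_index rep_prefix_2 rep_prefix_3)
  show "twisted_alexander_matrix n (theta_relator n) \<rho> \<alpha> 0 3 = t_power (1 - int n) * (1 + t_power 1)"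
    using entry[of 0] by (simp add: laurent_minus distrib_left t_power_mult)
  show "twisted_alexander_matrix n (theta_relator n) \<rho> \<alpha> 1 3 =
     t_power (1 - int n) * (t_power 1 + t_power 2)"
    using entry[of 1] by (simp add: laurent_uminus distrib_left t_power_mult)
qed

lemma alexander_last_block:
  "twisted_alexander_matrix n (theta_relator n) \<rho> \<alpha> 0 (2 * n - 2) = t_power (- 1) - 1"
  "twisted_alexander_matrix n (theta_relator n) \<rho> \<alpha> 1 (2 * n - 2) = t_power 1"
proof -
  let ?w = "prefix (n + 1) \<otimes>\<^bsub>F\<^esub> gen 1"
  have carriers: "prefix n \<in> carrier F" "prefix (n + 1) \<in> carrier F" "gen 1 \<in> carrier F"
    using n_ge_5 by (auto intro!: prefix_carrier gen_carrier)
  have last: "deg (prefix (n + 1)) = 0"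
    using relator_trivial(1)[of "theta_relator n"] by (simp add: prefix_last)
  then have deg: "deg (prefix n) = - 1" "deg ?w = 1"
    using deg_prefix_Suc[of n] deg_factor[of n] deg_gen[of "n - 1"] deg_gen[of 1] n_ge_5 carriers
      deg_mult[of "prefix (n + 1)" "gen 1"] by simp_all
  have "rep ?w = A"
    using rep_mult[of "prefix (n + 1)" "gen 1"] carriers rep_prefix_last rep_gens
    by (simp add: mat2_simps)
  then have entry: "twisted_alexander_matrix n (theta_relator n) \<rho> \<alpha> i (2 * n - 2) =
      t_power (- 1) * laurent_const (D $$ (i, 0)) - laurent_const (1\<^sub>m 2 $$ (i, 0))
      + t_power 1 * laurent_const (A $$ (i, 0))" if "i < 2" for i
    using twisted_alexander_matrix_entry[of n i 0] that n_ge_5 carriers twist_index[of ?w i 0] deg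
      last rep_prefix_last
    by (simp add: next_index_def twist_index rep_prefix_n t_power_0 diff_mult_distrib2)
  show "twisted_alexander_matrix n (theta_relator n) \<rho> \<alpha> 0 (2 * n - 2) = t_power (- 1) - 1"
    "twisted_alexander_matrix n (theta_relator n) \<rho> \<alpha> 1 (2 * n - 2) = t_power 1"
    using entry[of 0] entry[of 1] by simp_all
qed

section \<open>Minors and elementary ideals\<close>

abbreviation alexander :: "nat \<Rightarrow> nat \<Rightarrow> laurent2" where
  "alexander \<equiv> twisted_alexander_matrix n (theta_relator n) \<rho> \<alpha>"

lemma one_plus_t_dvd_top_row: "1 + t_power 1 dvd alexander 0 c"
proof (cases "c < 2 * n")
  case True
  then have j: "c div 2 + 1 \<in> {1..n}" by auto
  then show ?thesis
    using one_plus_t_dvd_entry[OF j, of 0 "c mod 2"] fox_sum_top_row[OF j, of "c mod 2"] by simp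
qed (simp add: twisted_alexander_matrix_def)

text \<open>A minor of size 2 either uses the top row or reaches a row of index at least 2, which is zero.\<close>
lemma one_plus_t_dvd_minor:
  assumes "x \<in> minors (2 * n) alexander 2"
  shows "1 + t_power 1 dvd x"
proof -
  obtain f g where x: "x = det (mat 2 2 (\<lambda>(i, j). alexander (f i) (g j)))"
    and f: "strict_mono_on {..<2 :: nat} f"
    using assms unfolding minors_def by blast
  have x: "x = alexander (f 0) (g 0) * alexander (f 1) (g 1) - alexander (f 0) (g 1) * alexander (f 1) (g 0)"
    unfolding x by (simp add: det_mat_2_2)
  have "f 0 < f 1" using strict_mono_onD[OF f, of 0 1] by simp
  then consider "f 0 = 0" | "f 1 \<ge> 2" by linarith
  then show ?thesis
  proof cases
    case 1
    then show ?thesis unfolding x by (simp add: one_plus_t_dvd_top_row dvd_diff)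
  next
    case 2
    then show ?thesis unfolding x by (simp add: twisted_alexander_matrix_def)
  qed
qed

text \<open>The witness that no further common factor exists: columns 3 and \<open>2 n - 2\<close>, the second column of the
  second block and the first column of the last block.\<close>
lemma second_last_minor:
  "t_power (1 - int n) * (1 + t_power 1) \<in> minors (2 * n) alexander 2"
proof -
  define g where "g i = (if i = 0 then 3 else 2 * n - 2)" for i :: nat
  have t2: "t_power 2 = t_power 1 * t_power 1" by (simp add: t_power_mult)
  have inv: "t_power 1 * t_power (- 1) = 1" by (simp add: t_power_mult t_power_0)
  have "det (mat 2 2 (\<lambda>(i, j). alexander (id i) (g j))) =
      t_power (1 - int n) * (1 + t_power 1) * t_power 1
      - (t_power (- 1) - 1) * (t_power (1 - int n) * (t_power 1 + t_power 2))"
    by (simp add: det_mat_2_2 g_def alexander_second_block alexander_last_block)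
  also have "\<dots> = t_power (1 - int n) * (1 + t_power 1) *
      (t_power 1 - t_power 1 * t_power (- 1) + t_power 1)"
    by (simp add: t2 algebra_simps)
  also have "\<dots> = t_power (1 - int n) * (1 + t_power 1)"
  proof -
    have "t_power 1 - 1 + t_power 1 = (1 :: laurent2)"
      using laurent_minus[of "t_power 1" 1] laurent_minus[of 1 "t_power 1"]
      by (metis add.commute diff_add_cancel)
    then show ?thesis by (simp only: inv mult_1_right)
  qed
  finally have "det (mat 2 2 (\<lambda>(i, j). alexander (id i) (g j))) = t_power (1 - int n) * (1 + t_power 1)" .
  moreover have "strict_mono_on {..<2} g" "g ` {..<2} \<subseteq> {..<2 * n}"
    using n_ge_5 by (auto simp: g_def strict_mono_on_def)
  moreover have "strict_mono_on {..<2} (id :: nat \<Rightarrow> nat)"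
    by (simp add: strict_mono_on_def)
  ultimately show ?thesis
    unfolding minors_def by (intro CollectI exI[of _ id] exI[of _ g]) simp
qed

lemma t_in_minors: "t_power 1 \<in> minors (2 * n) alexander 1"
proof -
  have "det (mat 1 1 (\<lambda>(i, j). alexander 1 (2 * n - 2))) = t_power 1"
    by (subst det_single) (auto simp: alexander_last_block)
  then show ?thesis
    unfolding minors_def using n_ge_5
    by (intro CollectI exI[of _ "\<lambda>_. 1"] exI[of _ "\<lambda>_. 2 * n - 2"]) (auto simp: strict_mono_on_def)
qed

theorem elementary_ideals:
  "elementary_ideal (2 * n) 2 alexander d =
    (if d < 2 * n - 2 then Idl\<^bsub>univ_ring\<^esub> {0}
     else if d = 2 * n - 2 then Idl\<^bsub>univ_ring\<^esub> {1 + t_power 1}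
     else Idl\<^bsub>univ_ring\<^esub> {1})"
proof -
  consider "d < 2 * n - 2" | "d = 2 * n - 2" | "d = 2 * n - 1" | "2 * n \<le> d" by linarith
  then show ?thesis
  proof cases
    case 1
    then have "\<not> 2 * n \<le> d" "\<not> 2 * n - d \<le> 2" by linarith+
    then show ?thesis using 1 by (simp add: elementary_ideal_def)
  next
    case 2
    have unit: "t_power (int n - 1) * t_power (1 - int n) = 1"
      by (simp add: t_power_mult t_power_0)
    have "t_power (1 - int n) * (1 + t_power 1) dvd 1 + t_power 1"
      by (rule dvdI[of _ _ "t_power (int n - 1)"]) (metis unit mult.assoc mult.commute mult.right_neutral)
    then have "Idl\<^bsub>univ_ring\<^esub> (minors (2 * n) alexander 2) = Idl\<^bsub>univ_ring\<^esub> {1 + t_power 1}"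
      using one_plus_t_dvd_minor second_last_minor by (intro Idl_univ_ring_eq_principal)
    moreover have "\<not> 2 * n \<le> d" "2 * n - d = 2" using 2 n_ge_5 by linarith+
    ultimately show ?thesis using 2 by (simp add: elementary_ideal_def)
  next
    case 3
    have "t_power 1 dvd 1"
      by (rule dvdI[of _ _ "t_power (- 1)"]) (simp add: t_power_mult t_power_0)
    then have "Idl\<^bsub>univ_ring\<^esub> (minors (2 * n) alexander 1) = Idl\<^bsub>univ_ring\<^esub> {1}"
      using t_in_minors by (intro Idl_univ_ring_eq_principal) auto
    moreover have "\<not> 2 * n \<le> d" "2 * n - d = 1" "\<not> d < 2 * n - 2" "d \<noteq> 2 * n - 2"
      using 3 n_ge_5 by linarith+
    ultimately show ?thesis by (simp add: elementary_ideal_def)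
  next
    case 4
    then have "\<not> d < 2 * n - 2" "d \<noteq> 2 * n - 2" using n_ge_5 by linarith+
    then show ?thesis using 4 by (simp add: elementary_ideal_def)
  qed
qed

end

theorem theorem3p6:
  fixes n d :: nat
    and \<alpha> :: "nat letter list set \<Rightarrow> int"
    and \<rho> :: "nat letter list set \<Rightarrow> bit mat"
  assumes n: "n \<ge> 3" "n mod 6 = 1 \<or> n mod 6 = 5"
    and \<alpha>_hom: "\<alpha> \<in> hom (theta_group n) integer_group"
    and \<alpha>_gen: "\<And>i. i \<in> {1..n - 1} \<Longrightarrow> \<alpha> (theta_gen n i) = 1"
    and \<alpha>_last: "\<alpha> (theta_gen n n) = 1 - int n"
    and \<rho>_hom: "\<rho> \<in> hom (theta_group n) SL2"
    and \<rho>_5: "\<And>k. n = 6 * k + 5 \<Longrightarrow>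
      (\<forall>i\<in>{1..6 * k + 3}. \<rho> (theta_gen n i) = mat_of_rows_list 2 [[0, 1], [1, 1]]) \<and>
      \<rho> (theta_gen n (6 * k + 4)) = mat_of_rows_list 2 [[0, 1], [1, 0]] \<and>
      \<rho> (theta_gen n (6 * k + 5)) = mat_of_rows_list 2 [[1, 0], [1, 1]]"
    and \<rho>_7: "\<And>k. n = 6 * k + 7 \<Longrightarrow>
      (\<forall>i\<in>{1..6 * k + 3}. \<rho> (theta_gen n i) = mat_of_rows_list 2 [[0, 1], [1, 1]]) \<and>
      (\<forall>i\<in>{6 * k + 4, 6 * k + 6}. \<rho> (theta_gen n i) = mat_of_rows_list 2 [[0, 1], [1, 0]]) \<and>
      (\<forall>i\<in>{6 * k + 5, 6 * k + 7}. \<rho> (theta_gen n i) = mat_of_rows_list 2 [[1, 0], [1, 1]])"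
  shows "elementary_ideal (2 * n) 2 (twisted_alexander_matrix n (theta_relator n) \<rho> \<alpha>) d =
    (if d < 2 * n - 2 then Idl\<^bsub>univ_ring\<^esub> {0}
     else if d = 2 * n - 2 then Idl\<^bsub>univ_ring\<^esub> {1 + t_power 1}
     else Idl\<^bsub>univ_ring\<^esub> {1})"
proof -
  have gens: "theta_gen n i = canonical_epi {1..n} {theta_relator n} (free_gen i)" for i
    by (simp add: theta_gen_def)
  interpret theta_twist n \<alpha> \<rho>
    using n(1) \<alpha>_hom \<rho>_hom by unfold_locales
  have gen_values: "deg (gen i) = \<alpha> (theta_gen n i)" "rep (gen i) = \<rho> (theta_gen n i)" for i
    by (simp_all add: deg_def rep_def gens)
  interpret theta_rep n \<alpha> \<rho>
  proof
    show "n \<ge> 5 \<and> (\<forall>i\<in>{1..n - 2}. rep (gen i) = A) \<and> rep (gen (n - 1)) = B \<and> rep (gen n) = C \<or>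
       n \<ge> 7 \<and> (\<forall>i\<in>{1..n - 4}. rep (gen i) = A) \<and> rep (gen (n - 3)) = B \<and> rep (gen (n - 2)) = C \<and>
         rep (gen (n - 1)) = B \<and> rep (gen n) = C"
      using n(2)
    proof
      assume "n mod 6 = 1"
      moreover define k where "k = n div 6 - 1"
      ultimately have k: "n = 6 * k + 7" using n(1) by presburger
      have index: "n - 4 = 6 * k + 3" "n - 3 = 6 * k + 4" "n - 2 = 6 * k + 5" "n - 1 = 6 * k + 6" "n \<ge> 7"
        using k by auto
      then show ?thesis unfolding gen_values index(1-4) using \<rho>_7[OF k, folded k] index(5) by blast
    next
      assume "n mod 6 = 5"
      moreover define k where "k = n div 6"
      ultimately have k: "n = 6 * k + 5" by presburger
      have index: "n - 2 = 6 * k + 3" "n - 1 = 6 * k + 4" "n \<ge> 5"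
        using k by auto
      then show ?thesis unfolding gen_values index(1-2) using \<rho>_5[OF k, folded k] index(3) by blast
    qed
  qed (use \<alpha>_gen \<alpha>_last in \<open>auto simp: gen_values\<close>)
  show ?thesis by (rule elementary_ideals)
qed

end
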